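(* Let $1<p<2$, $s\ge\frac1p-\frac12$, $t>\frac12$. Let $K:L^2(\mathbb{T})\to L^2(\mathbb{T})$ be diagonal in the basis $\{\psi_\ell\}_{\ell\ge1}$, i.e. $\langle\psi_\ell,K\psi_{\ell'}\rangle=0$ for $\ell\ne\ell'$, with $k_\ell=\langle\psi_\ell,K\psi_\ell\rangle\simeq\ell^{-t}$, and let $R(u)=\frac1p\|u\|_{B_p^s(\mathbb{T})}^p$. Assume that $\mu^\dagger\in\partial R(u^\dagger)$ satisfies the exact source condition $\mu^\dagger=K^*w$ for some $w\in L^2(\mathbb{T})$. For the choice $\alpha\simeq\delta^\kappa$, where $$\kappa=\frac{4(s+t)}{4(s+t)+1},$$ we obtain the convergence rate $$\mathbb{E}\,D_R^{\mu_\alpha^\delta,\mu^\dagger}(U_\alpha^\delta,u^\dagger)\lesssim\delta^\kappa.$$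
   Context: $\{\psi_\ell\}_{\ell=1}^\infty$ is an orthonormal wavelet basis (globally indexed, sufficiently regular to characterize the Besov spaces used) of $L^2(\mathbb{T})$, $\mathbb{T}$ the one-dimensional torus; $u=\sum_\ell u_\ell\psi_\ell$, and the Besov space $B_p^s(\mathbb{T})=B_{pp}^s(\mathbb{T})$ is normed by $\|u\|_{B_p^s}=\big(\sum_{\ell}\ell^{p(s+\frac12)-1}|u_\ell|^p\big)^{1/p}$. $X=Y=L^2(\mathbb{T})$; $R=\infty$ outside $B_p^s(\mathbb{T})$. $N$ is Gaussian white noise on $\mathbb{T}$: a centered Gaussian random variable in $\mathcal{D}'(\mathbb{T})$ with $\mathbb{E}\langle N,\phi\rangle\langle N,\psi\rangle=\langle\phi,\psi\rangle$ for test functions; the coefficients $N_\ell=\langle N,\psi_\ell\rangle$ are i.i.d. standard normal. The data are $F^\delta=Ku^\dagger+\delta N$, $\delta>0$, with deterministic $u^\dagger$. $U_\alpha^\delta$ is, realization-wise, a minimizer of $\frac12\|Ku\|_{L^2}^2-\langle Ku,F^\delta\rangle+\alpha R(u)$ (the pairing being the $H^t\times H^{-t}$ duality), and $\mu_\alpha^\delta\in\partial R(U_\alpha^\delta)$ is the subgradient with $K^*(KU_\alpha^\delta-F^\delta)+\alpha\mu_\alpha^\delta=0$. The symmetric Bregman distance is $D_R^{\mu_u,\mu_v}(u,v)=\langle\mu_u-\mu_v,u-v\rangle$. $a\simeq b$ means mutual boundedness by constant multiples and $a\lesssim b$ means $a\le Cb$; for rates in $\delta$ the constants are independent of $\delta$,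 as $\delta\to0$. *)

theory Defs
  imports "HOL-Probability.Probability" "HOL-Library.Landau_Symbols"
begin

section \<open>The Hilbert space $L^2$ of the one-dimensional torus\<close>

text \<open>The torus is the real line modulo 1. Up to null sets, functions on it are functions on the
  fundamental domain $[0,1)$.\<close>

definition torus :: "real measure" where
  "torus = restrict_space lborel {0..<1}"

definition l2_fun :: "(real \<Rightarrow> real) \<Rightarrow> bool" where
  "l2_fun f \<longleftrightarrow> f \<in> borel_measurable torus \<and> integrable torus (\<lambda>x. (f x)\<^sup>2)"

definition l2_rel :: "(real \<Rightarrow> real) \<Rightarrow> (real \<Rightarrow> real) \<Rightarrow> bool" where
  "l2_rel f g \<longleftrightarrow> l2_fun f \<and> l2_fun g \<and> (AE x in torus. f x = g x)"

lemma l2_fun_zero: "l2_fun (\<lambda>_. 0)"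
  by (simp add: l2_fun_def)

lemma l2_fun_mult_integrable:
  assumes "l2_fun f" "l2_fun g"
  shows "integrable torus (\<lambda>x. f x * g x)"
proof (rule Bochner_Integration.integrable_bound)
  show "integrable torus (\<lambda>x. (f x)\<^sup>2 + (g x)\<^sup>2)"
    using assms by (simp add: l2_fun_def)
  show "(\<lambda>x. f x * g x) \<in> borel_measurable torus"
    using assms by (auto simp: l2_fun_def intro: borel_measurable_times)
  show "AE x in torus. norm (f x * g x) \<le> norm ((f x)\<^sup>2 + (g x)\<^sup>2)"
  proof (intro AE_I2)
    fix x
    have "2 * (\<bar>f x\<bar> * \<bar>g x\<bar>) \<le> (f x)\<^sup>2 + (g x)\<^sup>2"
      using zero_le_power2[of "\<bar>f x\<bar> - \<bar>g x\<bar>"] by (simp add: power2_diff)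
    then have "\<bar>f x\<bar> * \<bar>g x\<bar> \<le> (f x)\<^sup>2 + (g x)\<^sup>2"
      using mult_nonneg_nonneg[of "\<bar>f x\<bar>" "\<bar>g x\<bar>"] by linarith
    then show "norm (f x * g x) \<le> norm ((f x)\<^sup>2 + (g x)\<^sup>2)"
      by (simp add: abs_mult)
  qed
qed

lemma l2_fun_add:
  assumes "l2_fun f" "l2_fun g"
  shows "l2_fun (\<lambda>x. f x + g x)"
proof -
  have "integrable torus (\<lambda>x. (f x)\<^sup>2 + (g x)\<^sup>2 + 2 * (f x * g x))"
    using assms l2_fun_mult_integrable[OF assms] by (simp add: l2_fun_def)
  then show ?thesis
    using assms by (auto simp: l2_fun_def power2_sum mult.assoc intro: borel_measurable_add)
qed

lemma l2_fun_scale: "l2_fun f \<Longrightarrow> l2_fun (\<lambda>x. c * f x)"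
  by (auto simp: l2_fun_def power_mult_distrib intro: borel_measurable_times)

lemma l2_fun_uminus: "l2_fun f \<Longrightarrow> l2_fun (\<lambda>x. - f x)"
  using l2_fun_scale[of f "-1"] by simp

lemma l2_fun_diff: "l2_fun f \<Longrightarrow> l2_fun g \<Longrightarrow> l2_fun (\<lambda>x. f x - g x)"
  using l2_fun_add[of f "\<lambda>x. - g x"] l2_fun_uminus[of g] by simp

lemma l2_rel_refl: "l2_rel f f \<longleftrightarrow> l2_fun f"
  by (simp add: l2_rel_def)

lemma part_equivp_l2_rel: "part_equivp l2_rel"
proof (rule part_equivpI)
  show "\<exists>f. l2_rel f f"
    using l2_fun_zero l2_rel_refl by blast
  show "symp l2_rel"
    by (auto simp: symp_def l2_rel_def elim: AE_mp)
  show "transp l2_rel"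
  proof (rule transpI)
    fix f g h assume "l2_rel f g" "l2_rel g h"
    then show "l2_rel f h"
      unfolding l2_rel_def by (auto elim: eventually_elim2)
  qed
qed

text \<open>The class of a function \<open>f\<close> is \<open>abs_l2_torus f\<close>; it is meaningful only if \<open>l2_fun f\<close>.\<close>

quotient_type l2_torus = "real \<Rightarrow> real" / partial: l2_rel
  by (rule part_equivp_l2_rel)

instantiation l2_torus :: real_inner
begin

lift_definition zero_l2_torus :: l2_torus is "\<lambda>_. 0"
  by (simp add: l2_rel_refl l2_fun_zero)

lift_definition plus_l2_torus :: "l2_torus \<Rightarrow> l2_torus \<Rightarrow> l2_torus" is "\<lambda>f g x. f x + g x"
  unfolding l2_rel_def by (auto simp: l2_fun_add elim: eventually_elim2)

lift_definition minus_l2_torus :: "l2_torus \<Rightarrow> l2_torus \<Rightarrow> l2_torus" is "\<lambda>f g x. f x - g x"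
  unfolding l2_rel_def by (auto simp: l2_fun_diff elim: eventually_elim2)

lift_definition uminus_l2_torus :: "l2_torus \<Rightarrow> l2_torus" is "\<lambda>f x. - f x"
  unfolding l2_rel_def by (auto simp: l2_fun_uminus)

lift_definition scaleR_l2_torus :: "real \<Rightarrow> l2_torus \<Rightarrow> l2_torus" is "\<lambda>c f x. c * f x"
  unfolding l2_rel_def by (auto simp: l2_fun_scale elim: eventually_mono)

lift_definition inner_l2_torus :: "l2_torus \<Rightarrow> l2_torus \<Rightarrow> real"
  is "\<lambda>f g. LINT x|torus. f x * g x"
  unfolding l2_rel_def
  by (intro integral_cong_AE) (auto simp: l2_fun_def elim: eventually_elim2)

definition norm_l2_torus :: "l2_torus \<Rightarrow> real" where
  "norm_l2_torus u = sqrt (inner u u)"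

definition dist_l2_torus :: "l2_torus \<Rightarrow> l2_torus \<Rightarrow> real" where
  "dist_l2_torus u v = norm (u - v)"

definition sgn_l2_torus :: "l2_torus \<Rightarrow> l2_torus" where
  "sgn_l2_torus u = scaleR (inverse (norm u)) u"

definition uniformity_l2_torus :: "(l2_torus \<times> l2_torus) filter" where
  "uniformity_l2_torus = (INF e\<in>{0<..}. principal {(x, y). dist x y < e})"

definition open_l2_torus :: "l2_torus set \<Rightarrow> bool" where
  "open_l2_torus U \<longleftrightarrow> (\<forall>x\<in>U. \<forall>\<^sub>F (x', y) in uniformity. x' = x \<longrightarrow> y \<in> U)"

instance
proof
  fix a b c :: l2_torus and r q :: real
  show "a + b + c = a + (b + c)"
    by transfer (auto simp: l2_rel_def l2_fun_add)
  show "a + b = b + a"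
    by transfer (auto simp: l2_rel_def l2_fun_add)
  show "0 + a = a"
    by transfer (auto simp: l2_rel_def)
  show "- a + a = 0"
    by transfer (auto simp: l2_rel_def l2_fun_zero)
  show "a - b = a + - b"
    by transfer (auto simp: l2_rel_def l2_fun_diff)
  show "r *\<^sub>R (a + b) = r *\<^sub>R a + r *\<^sub>R b"
    by transfer (auto simp: l2_rel_def l2_fun_add l2_fun_scale algebra_simps)
  show "(r + q) *\<^sub>R a = r *\<^sub>R a + q *\<^sub>R a"
    by transfer (auto simp: l2_rel_def l2_fun_add l2_fun_scale distrib_right)
  show "r *\<^sub>R q *\<^sub>R a = (r * q) *\<^sub>R a"
    by transfer (auto simp: l2_rel_def l2_fun_scale mult.assoc)
  show "1 *\<^sub>R a = a"
    by transfer (auto simp: l2_rel_def)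
  show "dist a b = norm (a - b)"
    by (rule dist_l2_torus_def)
  show "sgn a = inverse (norm a) *\<^sub>R a"
    by (rule sgn_l2_torus_def)
  show "uniformity = (INF e\<in>{0<..}. principal {(x, y :: l2_torus). dist x y < e})"
    by (rule uniformity_l2_torus_def)
  show "open U \<longleftrightarrow> (\<forall>x\<in>U. \<forall>\<^sub>F (x', y) in uniformity. x' = x \<longrightarrow> y \<in> U)" for U :: "l2_torus set"
    by (rule open_l2_torus_def)
  show "inner a b = inner b a"
    by transfer (simp add: mult.commute)
  show "inner (a + b) c = inner a c + inner b c"
    by transfer (simp add: l2_rel_refl distrib_right l2_fun_mult_integrable)
  show "inner (r *\<^sub>R a) b = r * inner a b"
    by transfer (simp add: mult.assoc)
  show "0 \<le> inner a a"
    by transfer simp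
  show "inner a a = 0 \<longleftrightarrow> a = 0"
  proof transfer
    fix f assume "l2_rel f f"
    then have f: "l2_fun f" by (simp add: l2_rel_refl)
    then have "(LINT x|torus. f x * f x) = 0 \<longleftrightarrow> (AE x in torus. f x * f x = 0)"
      by (intro integral_nonneg_eq_0_iff_AE) (auto intro: l2_fun_mult_integrable)
    then show "(LINT x|torus. f x * f x) = 0 \<longleftrightarrow> l2_rel f (\<lambda>_. 0)"
      using f by (simp add: l2_rel_def l2_fun_zero)
  qed
  show "norm a = sqrt (inner a a)"
    by (rule norm_l2_torus_def)
qed

end


section \<open>Periodized wavelet bases\<close>

text \<open>Orthonormality and totality of a family indexed by $\ell \ge 1$; the value at 0 is irrelevant.\<close>

definition orthonormal_basis :: "(nat \<Rightarrow> l2_torus) \<Rightarrow> bool" where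
  "orthonormal_basis \<psi> \<longleftrightarrow>
     (\<forall>l\<ge>1. \<forall>m\<ge>1. inner (\<psi> l) (\<psi> m) = (if l = m then 1 else 0)) \<and>
     closure (span (\<psi> ` {1..})) = UNIV"

text \<open>A mother wavelet of regularity \<open>r\<close>: \<open>r\<close> times continuously differentiable, all derivatives up to
  order \<open>r\<close> rapidly decreasing, and vanishing moments up to order \<open>r - 1\<close>.\<close>

definition mother_wavelet :: "nat \<Rightarrow> (real \<Rightarrow> real) \<Rightarrow> bool" where
  "mother_wavelet r \<eta> \<longleftrightarrow>
     (\<forall>i<r. \<forall>x. (deriv ^^ i) \<eta> differentiable (at x)) \<and>
     continuous_on UNIV ((deriv ^^ r) \<eta>) \<and>
     (\<forall>i\<le>r. \<forall>n::nat. \<exists>C. \<forall>x. \<bar>(deriv ^^ i) \<eta> x\<bar> * (1 + \<bar>x\<bar>) ^ n \<le> C) \<and>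
     (\<forall>i<r. (LINT x|lborel. x ^ i * \<eta> x) = 0)"

definition periodized :: "(real \<Rightarrow> real) \<Rightarrow> nat \<Rightarrow> nat \<Rightarrow> real \<Rightarrow> real" where
  "periodized \<eta> j k x =
     (\<Sum>\<^sub>\<infinity>m::int. 2 powr (real j / 2) * \<eta> (2 ^ j * (x + of_int m) - real k))"

text \<open>Global indexing: $\ell = 1$ is the constant scaling function and $\ell = 2^j + k + 1$ is the
  wavelet with scale $j \ge 0$ and position $0 \le k < 2^j$.\<close>

definition wavelet_basis :: "nat \<Rightarrow> (nat \<Rightarrow> l2_torus) \<Rightarrow> bool" where
  "wavelet_basis r \<psi> \<longleftrightarrow> orthonormal_basis \<psi> \<and>
     \<psi> 1 = abs_l2_torus (\<lambda>_. 1) \<and>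
     (\<exists>\<eta>. mother_wavelet r \<eta> \<and>
        (\<forall>j k. k < 2 ^ j \<longrightarrow> \<psi> (2 ^ j + k + 1) = abs_l2_torus (periodized \<eta> j k)))"


section \<open>Besov penalty, subdifferential, Bregman distance\<close>

definition in_besov :: "(nat \<Rightarrow> l2_torus) \<Rightarrow> real \<Rightarrow> real \<Rightarrow> l2_torus \<Rightarrow> bool" where
  "in_besov \<psi> p s u \<longleftrightarrow>
     (\<lambda>l. real l powr (p * (s + 1/2) - 1) * \<bar>inner u (\<psi> l)\<bar> powr p) summable_on {1..}"

definition besov_norm :: "(nat \<Rightarrow> l2_torus) \<Rightarrow> real \<Rightarrow> real \<Rightarrow> l2_torus \<Rightarrow> real" where
  "besov_norm \<psi> p s u =
     (\<Sum>\<^sub>\<infinity>l\<in>{1..}. real l powr (p * (s + 1/2) - 1) * \<bar>inner u (\<psi> l)\<bar> powr p) powr (1 / p)"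

definition besov_penalty :: "(nat \<Rightarrow> l2_torus) \<Rightarrow> real \<Rightarrow> real \<Rightarrow> l2_torus \<Rightarrow> ereal" where
  "besov_penalty \<psi> p s u =
     (if in_besov \<psi> p s u then ereal (1 / p * besov_norm \<psi> p s u powr p) else \<infinity>)"

text \<open>The dual of the Hilbert space is identified with the space itself.\<close>

definition subdifferential :: "('a::real_inner \<Rightarrow> ereal) \<Rightarrow> 'a \<Rightarrow> 'a set" where
  "subdifferential R u =
     {\<mu>. \<bar>R u\<bar> \<noteq> \<infinity> \<and> (\<forall>v. R u + ereal (inner \<mu> (v - u)) \<le> R v)}"

definition sym_bregman :: "'a::real_inner \<Rightarrow> 'a \<Rightarrow> 'a \<Rightarrow> 'a \<Rightarrow> real" where
  "sym_bregman \<mu>u \<mu>v u v = inner (\<mu>u - \<mu>v) (u - v)"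


section \<open>Gaussian white noise\<close>

definition test_function :: "(real \<Rightarrow> real) \<Rightarrow> bool" where
  "test_function \<phi> \<longleftrightarrow>
     (\<forall>x. \<phi> (x + 1) = \<phi> x) \<and> (\<forall>n x. (deriv ^^ n) \<phi> differentiable (at x))"

text \<open>Distributions as linear functionals on test functions that are continuous for the seminorms
  $\sup |\phi^{(i)}|$. Values at functions that are not test functions are irrelevant.\<close>

definition torus_distribution :: "((real \<Rightarrow> real) \<Rightarrow> real) \<Rightarrow> bool" where
  "torus_distribution T \<longleftrightarrow>
     (\<forall>\<phi> \<rho> a b. test_function \<phi> \<longrightarrow> test_function \<rho> \<longrightarrow>
        T (\<lambda>x. a * \<phi> x + b * \<rho> x) = a * T \<phi> + b * T \<rho>) \<and>
     (\<exists>C n. \<forall>\<phi>. test_function \<phi> \<longrightarrow>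
        \<bar>T \<phi>\<bar> \<le> C * (\<Sum>i\<le>n. SUP x. \<bar>(deriv ^^ i) \<phi> x\<bar>))"

text \<open>The point mass at 0 counts as a (degenerate) centered Gaussian.\<close>

definition centered_gaussian :: "'w measure \<Rightarrow> ('w \<Rightarrow> real) \<Rightarrow> bool" where
  "centered_gaussian M X \<longleftrightarrow> X \<in> borel_measurable M \<and>
     ((AE \<omega> in M. X \<omega> = 0) \<or>
      (\<exists>\<sigma>>0. distributed M lborel X (\<lambda>x. ennreal (normal_density 0 \<sigma> x))))"

definition white_noise :: "'w measure \<Rightarrow> ('w \<Rightarrow> (real \<Rightarrow> real) \<Rightarrow> real) \<Rightarrow> bool" where
  "white_noise M N \<longleftrightarrow>
     (\<forall>\<omega>\<in>space M. torus_distribution (N \<omega>)) \<and>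
     (\<forall>\<phi>. test_function \<phi> \<longrightarrow> centered_gaussian M (\<lambda>\<omega>. N \<omega> \<phi>)) \<and>
     (\<forall>\<phi> \<rho>. test_function \<phi> \<longrightarrow> test_function \<rho> \<longrightarrow>
        (LINT \<omega>|M. N \<omega> \<phi> * N \<omega> \<rho>) = inner (abs_l2_torus \<phi>) (abs_l2_torus \<rho>))"

text \<open>Wavelets of finite smoothness are not test functions. The pairing of white noise with
  \<open>f\<close> in $L^2$ is the (almost surely unique) random variable \<open>Z\<close> obtained by continuous extension:
  the mean-square limit of the pairings with test functions converging to \<open>f\<close> in $L^2$.
  By the covariance identity the limit does not depend on the approximating sequence.\<close>

definition noise_pairing ::
  "'w measure \<Rightarrow> ('w \<Rightarrow> (real \<Rightarrow> real) \<Rightarrow> real) \<Rightarrow> l2_torus \<Rightarrow> ('w \<Rightarrow> real) \<Rightarrow> bool" where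
  "noise_pairing M N f Z \<longleftrightarrow> Z \<in> borel_measurable M \<and>
     (\<exists>\<phi>. (\<forall>n. test_function (\<phi> n)) \<and>
        (\<lambda>n. abs_l2_torus (\<phi> n)) \<longlonglongrightarrow> f \<and>
        (\<lambda>n. \<integral>\<^sup>+\<omega>. ennreal ((N \<omega> (\<phi> n) - Z \<omega>)\<^sup>2) \<partial>M) \<longlonglongrightarrow> 0)"


section \<open>Variational regularization with rough data\<close>

text \<open>Elements of $H^{-t}$ are represented by their wavelet coefficients. As
  $\|g\|_{H^t}^2 = \sum_\ell \ell^{2t} |g_\ell|^2$, the $H^t \times H^{-t}$ duality is the coefficient
  pairing, which extends the $L^2$ inner product.\<close>

definition dual_pairing :: "(nat \<Rightarrow> l2_torus) \<Rightarrow> l2_torus \<Rightarrow> (nat \<Rightarrow> real) \<Rightarrow> real" where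
  "dual_pairing \<psi> g F = (\<Sum>\<^sub>\<infinity>l\<in>{1..}. inner g (\<psi> l) * F l)"

text \<open>The adjoint $K^* : H^{-t} \to L^2$ of $K : L^2 \to H^t$.\<close>

definition dual_adjoint ::
  "(nat \<Rightarrow> l2_torus) \<Rightarrow> (l2_torus \<Rightarrow> l2_torus) \<Rightarrow> (nat \<Rightarrow> real) \<Rightarrow> l2_torus" where
  "dual_adjoint \<psi> K F = (THE h. \<forall>f. inner h f = dual_pairing \<psi> (K f) F)"

definition tikhonov ::
  "(nat \<Rightarrow> l2_torus) \<Rightarrow> (l2_torus \<Rightarrow> l2_torus) \<Rightarrow> (l2_torus \<Rightarrow> ereal) \<Rightarrow> real \<Rightarrow>
   (nat \<Rightarrow> real) \<Rightarrow> l2_torus \<Rightarrow> ereal" where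
  "tikhonov \<psi> K R \<alpha> F u =
     ereal (1/2 * (norm (K u))\<^sup>2 - dual_pairing \<psi> (K u) F) + ereal \<alpha> * R u"

end

theory Submission
  imports Defs
begin

text \<open>In the wavelet coordinates the problem decouples. Let $u_l, v_l, w_l$ be the coefficients of
  the minimizer, of the true solution and of the source element, $a_l$ the Besov weight,
  $\varphi(x) = |x|^{p-1}\mathrm{sgn}(x)$, $\varrho_l = \delta N_l/\alpha$ and
  $m_l = a_l(\varphi(u_l) - \varphi(v_l))$. Subgradients of the penalty have the coefficients
  $a_l\varphi(u_l)$, so the symmetric Bregman distance is $\sum_l m_l(u_l - v_l)$, a series of
  nonnegative terms. The operator is self-adjoint, and the source condition reads
  $a_l\varphi(v_l) = k_l w_l$. Perturbing the minimizer in one coordinate gives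
  \[ \frac{k_l^2}{\alpha}(u_l - v_l) + m_l = k_l(\varrho_l - w_l). \]

  Each coordinate is estimated in two ways. Completing the square gives
  $m_l(u_l - v_l) \le \frac{\alpha}{2}(\varrho_l^2 + w_l^2)$ (\<open>coordinate_bregman_low\<close>); the expectation of
  $\alpha\varrho_l^2$ does not decay in $l$, so this is good at low frequencies only. For the high
  frequencies, the two summands on the left of the equation have the same sign. Hence
  $|m_l|$, $|a_l\varphi(u_l)|$ and $|a_l\varphi(v_l)|$ are all at most
  $X = k_l(|\varrho_l| + 2|w_l|)$; inverting $\varphi$ bounds $|u_l|$ and $|v_l|$ by $(X/a_l)^{q-1}$
  with $q = p/(p-1)$, and so $m_l(u_l - v_l) \le 2X^q a_l^{1-q}$ (\<open>coordinate_bregman_high\<close>). Here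
  $k_l^q a_l^{1-q} \lesssim l^{-\beta}$ with $\beta = q(s + t - \frac12) + 1 > 1$.

  The second and the $q$-th absolute moments of the $N_l$ are bounded uniformly in $l$. Using the
  first estimate for $l \le n$ and the second for $l > n$, where $|w_l|^q \lesssim w_l^2$ is
  summable, yields
  \[ \mathbb{E}\sum_l m_l(u_l - v_l) \lesssim \alpha + \frac{n\delta^2}{\alpha}
     + \Big(\frac{\delta}{\alpha}\Big)^q n^{1-\beta} + n^{-\beta} \]
  (\<open>sequence_model_bregman\<close>). With $\alpha \simeq \delta^\kappa$ and $n \simeq \delta^{-2(1-\kappa)}$ the
  second term is of order $\delta^\kappa$, and the last two are not larger because $q \ge 2$ and
  $s + t > \frac12$ (\<open>bregman_rate\<close>).

  Every $u_l$ is almost surely a monotone function of $N_l$. The Bregman distance therefore agrees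
  almost surely with a measurable random variable, which makes it measurable for the completion.\<close>

section \<open>Coordinates in a total orthonormal sequence\<close>

text \<open>Indexing by all natural numbers lets the series lemmas of the reals apply directly; the
  $i$-th member of the sequence belongs to the wavelet with index $l = i + 1$.\<close>

definition total_orthonormal :: "(nat \<Rightarrow> 'a::real_inner) \<Rightarrow> bool" where
  "total_orthonormal e \<longleftrightarrow>
     (\<forall>i j. inner (e i) (e j) = (if i = j then 1 else 0)) \<and> closure (span (range e)) = UNIV"

lemma orthonormal_basis_shift:
  assumes "orthonormal_basis \<psi>"
  shows "total_orthonormal (\<lambda>i. \<psi> (Suc i))"
proof -
  have "range (\<lambda>i. \<psi> (Suc i)) = \<psi> ` {1..}"
    by (simp add: atLeast_Suc_greaterThan image_image[symmetric] greaterThan_0)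
  then show ?thesis
    using assms by (simp add: orthonormal_basis_def total_orthonormal_def)
qed

lemma total_orthonormalD:
  assumes "total_orthonormal e"
  shows "inner (e i) (e j) = (if i = j then 1 else 0)"
  using assms by (simp add: total_orthonormal_def)

lemma bessel_partial:
  assumes e: "total_orthonormal e"
  shows "norm (\<Sum>i<n. inner x (e i) *\<^sub>R e i) \<le> norm x"
proof -
  let ?P = "\<Sum>i<n. inner x (e i) *\<^sub>R e i"
  have 1: "inner ?P ?P = (\<Sum>i<n. (inner x (e i))\<^sup>2)"
    by (simp add: inner_sum_left inner_sum_right total_orthonormalD[OF e] power2_eq_square
        if_distrib[of "\<lambda>y. _ * y"] cong: if_cong)
  have 2: "inner x ?P = (\<Sum>i<n. (inner x (e i))\<^sup>2)"
    by (simp add: inner_sum_right power2_eq_square)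
  have "norm ?P * norm ?P = inner x ?P"
    using 1 2 by (simp add: norm_eq_sqrt_inner sum_nonneg)
  also have "\<dots> \<le> norm x * norm ?P"
    by (rule norm_cauchy_schwarz)
  finally show ?thesis
    by (cases "norm ?P = 0") (auto simp: mult_le_cancel_right)
qed

lemma expansion_span:
  assumes e: "total_orthonormal e" and v: "v \<in> span (range e)"
  shows "\<forall>\<^sub>F n in sequentially. (\<Sum>i<n. inner v (e i) *\<^sub>R e i) = v"
  using v
proof (induction rule: span_induct_alt)
  case base
  then show ?case by simp
next
  case (step c b y)
  then obtain j where j: "b = e j" by auto
  show ?case
    using step.IH eventually_gt_at_top[of j]
  proof eventually_elim
    case (elim n)
    have "(\<Sum>i<n. inner (e j) (e i) *\<^sub>R e i) = e j"
      using elim by (simp add: total_orthonormalD[OF e] if_distrib[of "\<lambda>z. z *\<^sub>R _"] cong: if_cong)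
    moreover have "(\<Sum>i<n. inner (c *\<^sub>R e j + y) (e i) *\<^sub>R e i) =
        c *\<^sub>R (\<Sum>i<n. inner (e j) (e i) *\<^sub>R e i) + (\<Sum>i<n. inner y (e i) *\<^sub>R e i)"
      by (simp add: inner_add_left scaleR_add_left sum.distrib scaleR_sum_right)
    ultimately show ?case using elim j by simp
  qed
qed

text \<open>The partial expansions are contractions that are eventually the identity on every element of the dense span.\<close>

lemma expansion_tendsto:
  assumes e: "total_orthonormal e"
  shows "(\<lambda>n. \<Sum>i<n. inner x (e i) *\<^sub>R e i) \<longlonglongrightarrow> x"
proof (rule LIMSEQ_I)
  fix \<epsilon> :: real assume "\<epsilon> > 0"
  have "x \<in> closure (span (range e))"
    using e by (simp add: total_orthonormal_def)
  then obtain v where v: "v \<in> span (range e)" "dist v x < \<epsilon> / 2"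
    using closure_approachable[of x] \<open>\<epsilon> > 0\<close> by (metis half_gt_zero)
  from expansion_span[OF e v(1)] obtain n0 where
    n0: "\<And>n. n \<ge> n0 \<Longrightarrow> (\<Sum>i<n. inner v (e i) *\<^sub>R e i) = v"
    by (auto simp: eventually_at_top_linorder)
  show "\<exists>n0. \<forall>n\<ge>n0. norm ((\<Sum>i<n. inner x (e i) *\<^sub>R e i) - x) < \<epsilon>"
  proof (intro exI allI impI)
    fix n assume "n \<ge> n0"
    have "(\<Sum>i<n. inner x (e i) *\<^sub>R e i) - x = (\<Sum>i<n. inner (x - v) (e i) *\<^sub>R e i) + (v - x)"
      using n0[OF \<open>n \<ge> n0\<close>] by (simp add: inner_diff_left scaleR_diff_left sum_subtractf)
    also have "norm \<dots> \<le> norm (x - v) + norm (v - x)"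
      using bessel_partial[OF e, where x = "x - v" and n = n] norm_triangle_ineq
      by (meson add_mono order_trans order_refl)
    also have "\<dots> < \<epsilon>"
      using v(2) by (simp add: dist_norm norm_minus_commute)
    finally show "norm ((\<Sum>i<n. inner x (e i) *\<^sub>R e i) - x) < \<epsilon>" .
  qed
qed

text \<open>The inner product with a fixed vector is continuous, so it may be applied to the partial
  expansions.\<close>

lemma parseval_sums:
  assumes e: "total_orthonormal e"
  shows "(\<lambda>i. inner x (e i) * inner y (e i)) sums inner x y"
proof -
  have "(\<lambda>n. inner (\<Sum>i<n. inner x (e i) *\<^sub>R e i) y) \<longlonglongrightarrow> inner x y"
    by (intro tendsto_inner expansion_tendsto[OF e] tendsto_const)
  then show ?thesis
    by (simp add: sums_def inner_sum_left inner_commute[of "e _" y])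
qed

lemma parseval_norm:
  assumes e: "total_orthonormal e"
  shows "(\<lambda>i. (inner x (e i))\<^sup>2) sums (norm x)\<^sup>2"
  using parseval_sums[OF e, of x x] by (simp add: power2_eq_square dot_square_norm)

lemma coordinates_eqI:
  assumes e: "total_orthonormal e" and eq: "\<And>i. inner x (e i) = inner y (e i)"
  shows "x = y"
proof -
  have "(\<lambda>i. (inner (x - y) (e i))\<^sup>2) sums 0"
    by (simp add: inner_diff_left eq)
  then have "(norm (x - y))\<^sup>2 = 0"
    using parseval_norm[OF e, of "x - y"] sums_unique2 by blast
  then show ?thesis by simp
qed

lemma abs_mult_le_squares: "\<bar>a * b\<bar> \<le> a\<^sup>2 + (b\<^sup>2 :: real)"
proof -
  have "2 * \<bar>a\<bar> * \<bar>b\<bar> \<le> a\<^sup>2 + b\<^sup>2" using sum_squares_bound[of "\<bar>a\<bar>" "\<bar>b\<bar>"] by simp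
  moreover have "0 \<le> \<bar>a\<bar> * \<bar>b\<bar>" by simp
  ultimately show ?thesis unfolding abs_mult by linarith
qed

lemma diagonal_on_basis:
  assumes e: "total_orthonormal e"
    and diag: "\<And>i j. i \<noteq> j \<Longrightarrow> inner (e i) (K (e j)) = 0"
  shows "K (e i) = inner (e i) (K (e i)) *\<^sub>R e i"
  by (rule coordinates_eqI[OF e]) (use diag in \<open>auto simp: total_orthonormalD[OF e] inner_commute\<close>)

text \<open>Continuity of the operator extends the diagonal action from finite expansions to the
  whole space.\<close>

lemma diagonal_coordinates:
  assumes e: "total_orthonormal e" and K: "bounded_linear K"
    and diag: "\<And>i j. i \<noteq> j \<Longrightarrow> inner (e i) (K (e j)) = 0"
  shows "inner (K x) (e i) = inner (e i) (K (e i)) * inner x (e i)"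
proof -
  interpret K: bounded_linear K by (rule K)
  have "(\<lambda>n. inner (K (\<Sum>j<n. inner x (e j) *\<^sub>R e j)) (e i)) \<longlonglongrightarrow> inner (K x) (e i)"
    by (intro tendsto_inner K.tendsto expansion_tendsto[OF e] tendsto_const)
  moreover have "(\<lambda>n. inner (K (\<Sum>j<n. inner x (e j) *\<^sub>R e j)) (e i)) \<longlonglongrightarrow>
      inner (e i) (K (e i)) * inner x (e i)"
  proof (rule tendsto_eventually)
    show "\<forall>\<^sub>F n in sequentially. inner (K (\<Sum>j<n. inner x (e j) *\<^sub>R e j)) (e i) =
        inner (e i) (K (e i)) * inner x (e i)"
      using eventually_gt_at_top[of i]
    proof eventually_elim
      case (elim n)
      have "inner (K (\<Sum>j<n. inner x (e j) *\<^sub>R e j)) (e i) = (\<Sum>j<n. inner x (e j) * inner (e i) (K (e j)))"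
        by (simp add: K.sum K.scaleR inner_sum_right inner_commute[of _ "e i"])
      also have "\<dots> = (\<Sum>j<n. if j = i then inner (e i) (K (e i)) * inner x (e i) else 0)"
        by (rule sum.cong) (use diag in auto)
      finally show ?case using elim by simp
    qed
  qed
  ultimately show ?thesis
    by (rule LIMSEQ_unique)
qed

text \<open>By Parseval both inner products are the same series.\<close>

lemma diagonal_adjoint:
  assumes e: "total_orthonormal e" and K: "bounded_linear K"
    and diag: "\<And>i j. i \<noteq> j \<Longrightarrow> inner (e i) (K (e j)) = 0"
  shows "adjoint K = K"
proof (rule adjoint_unique, intro allI)
  fix x y
  have "(\<lambda>i. inner (K x) (e i) * inner y (e i)) = (\<lambda>i. inner x (e i) * inner (K y) (e i))"
    by (simp add: diagonal_coordinates[OF e K diag] mult_ac fun_eq_iff)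
  then show "inner (K x) y = inner x (K y)"
    using parseval_sums[OF e, of "K x" y] parseval_sums[OF e, of x "K y"] sums_unique2 by metis
qed

section \<open>The signed power as the derivative of a power of the absolute value\<close>

text \<open>With $r = p - 1$ this is the derivative of $|x|^p/p$, the duality map of the real line.\<close>

definition signed_powr :: "real \<Rightarrow> real \<Rightarrow> real" where
  "signed_powr r x = sgn x * \<bar>x\<bar> powr r"

lemma abs_signed_powr: "\<bar>signed_powr r x\<bar> = \<bar>x\<bar> powr r"
  by (cases "x = 0") (auto simp: signed_powr_def abs_mult)

lemma signed_powr_strict_mono:
  assumes "r > 0" "x < y"
  shows "signed_powr r x < signed_powr r y"
proof -
  consider "0 \<le> x" | "x < 0" "0 < y" | "x < 0" "y = 0" | "y < 0" by linarith
  then show ?thesis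
  proof cases
    case 1
    then show ?thesis using assms powr_less_mono2[of r x y] by (cases "x = 0") (auto simp: signed_powr_def)
  next
    case 2
    then have "signed_powr r x < 0" "signed_powr r y > 0" by (auto simp: signed_powr_def)
    then show ?thesis by linarith
  next
    case 3
    then show ?thesis by (auto simp: signed_powr_def)
  next
    case 4
    then show ?thesis using assms powr_less_mono2[of r "-y" "-x"] by (auto simp: signed_powr_def)
  qed
qed

lemma signed_powr_diff_mult_nonneg:
  assumes "r > 0"
  shows "0 \<le> (signed_powr r x - signed_powr r y) * (x - y)"
proof -
  consider "x < y" | "x = y" | "y < x" by linarith
  then show ?thesis
    using signed_powr_strict_mono[OF assms, of x y] signed_powr_strict_mono[OF assms, of y x]
    by cases (auto simp: mult_nonneg_nonneg mult_nonpos_nonpos)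
qed

text \<open>The case that needs an argument is $x = 0$: the difference quotient is bounded by
  $|h|^{p-1}$, which tends to 0 because $p > 1$.\<close>

lemma abs_powr_has_derivative:
  assumes p: "p > 1"
  shows "((\<lambda>x. \<bar>x\<bar> powr p) has_real_derivative p * signed_powr (p - 1) x) (at x)"
proof -
  consider "x > 0" | "x < 0" | "x = 0" by linarith
  then show ?thesis
  proof cases
    case 1
    have "((\<lambda>x. x powr p) has_real_derivative p * x powr (p - 1)) (at x)"
      by (rule has_real_derivative_powr[OF 1])
    moreover have "\<forall>\<^sub>F y in nhds x. \<bar>y\<bar> powr p = y powr p"
      using eventually_nhds_in_open[of "{0<..}" x] 1 by (auto elim!: eventually_mono)
    ultimately show ?thesis
      using 1 by (subst DERIV_cong_ev[OF refl _ refl]) (auto simp: signed_powr_def)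
  next
    case 2
    have "((\<lambda>x. (- x) powr p) has_real_derivative p * (- x) powr (p - 1) * (- 1)) (at x)"
      by (rule DERIV_chain2[OF has_real_derivative_powr]) (use 2 in \<open>auto intro!: derivative_eq_intros\<close>)
    moreover have "\<forall>\<^sub>F y in nhds x. \<bar>y\<bar> powr p = (- y) powr p"
      using eventually_nhds_in_open[of "{..<0}" x] 2 by (auto elim!: eventually_mono)
    ultimately show ?thesis
      using 2 by (subst DERIV_cong_ev[OF refl _ refl]) (auto simp: signed_powr_def)
  next
    case 3
    have "((\<lambda>h. \<bar>h\<bar> powr p / h) \<longlongrightarrow> 0) (at (0::real))"
    proof (rule Lim_null_comparison)
      show "((\<lambda>h. \<bar>h\<bar> powr (p - 1)) \<longlongrightarrow> 0) (at (0::real))"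
        using p by (intro tendsto_zero_powrI[where b = "p - 1"]) (auto intro!: tendsto_eq_intros)
      show "\<forall>\<^sub>F h in at (0::real). norm (\<bar>h\<bar> powr p / h) \<le> \<bar>h\<bar> powr (p - 1)"
        unfolding eventually_at_filter
        by (rule always_eventually) (auto simp: powr_diff)
    qed
    then show ?thesis
      using 3 p by (simp add: has_field_derivative_iff signed_powr_def)
  qed
qed

section \<open>Bregman distance of a single coordinate\<close>

text \<open>Solving for $m$ turns $me$ into a quadratic polynomial in $ke$ whose maximum is
  $\alpha(\varrho - w)^2/4$.\<close>

lemma coordinate_bregman_low:
  fixes k \<alpha> e m \<rho> w :: real
  assumes \<alpha>: "\<alpha> > 0" and eq: "k\<^sup>2 / \<alpha> * e + m = k * (\<rho> - w)"
  shows "m * e \<le> \<alpha> * (\<rho>\<^sup>2 + w\<^sup>2) / 2"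
proof -
  have m: "m = k * (\<rho> - w) - k\<^sup>2 / \<alpha> * e" using eq by simp
  have "\<alpha> * (\<rho> - w)\<^sup>2 / 4 - m * e = (\<alpha> * (\<rho> - w) / 2 - k * e)\<^sup>2 / \<alpha>"
    unfolding m using \<alpha> by (simp add: power2_eq_square field_simps)
  moreover have "\<dots> \<ge> 0" using \<alpha> by simp
  moreover have "(\<rho> - w)\<^sup>2 \<le> 2 * (\<rho>\<^sup>2 + w\<^sup>2)"
    using zero_le_power2[of "\<rho> + w"] by (simp add: power2_eq_square algebra_simps)
  then have "\<alpha> * (\<rho> - w)\<^sup>2 / 4 \<le> \<alpha> * (2 * (\<rho>\<^sup>2 + w\<^sup>2)) / 4"
    using \<alpha> by (intro divide_right_mono mult_left_mono) auto
  ultimately show ?thesis by linarith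
qed

text \<open>The reason is that $u - v$ and $m$ have the same sign: \<open>eq\<close> then controls $m$, and with the
  source condition also the sizes of $u$ and $v$ themselves.\<close>

lemma coordinate_bregman_high:
  fixes k \<alpha> a u v \<rho> w :: real
  assumes p: "p > 1" and q: "q = p / (p - 1)"
    and \<alpha>: "\<alpha> > 0" and k: "k > 0" and a: "a > 0"
    and v: "a * signed_powr (p - 1) v = k * w"
    and m: "m = a * (signed_powr (p - 1) u - signed_powr (p - 1) v)"
    and eq: "k\<^sup>2 / \<alpha> * (u - v) + m = k * (\<rho> - w)"
  shows "m * (u - v) \<le> 2 * (k * (\<bar>\<rho>\<bar> + 2 * \<bar>w\<bar>)) powr q * a powr (1 - q)"
proof -
  define X where "X = k * (\<bar>\<rho>\<bar> + 2 * \<bar>w\<bar>)"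
  have X: "X \<ge> 0" using k by (simp add: X_def)
  have me: "0 \<le> m * (u - v)"
    using signed_powr_diff_mult_nonneg[of "p - 1" u v] p a by (simp add: m mult.assoc)
  \<comment> \<open>both summands on the left of \<open>eq\<close> have the same sign, so neither exceeds the right-hand side\<close>
  have "\<bar>m\<bar> \<le> \<bar>k * (\<rho> - w)\<bar>"
  proof -
    have c: "k\<^sup>2 / \<alpha> \<ge> 0" using \<alpha> by simp
    have "(k\<^sup>2 / \<alpha> * (u - v) + m)\<^sup>2 = (k\<^sup>2 / \<alpha> * (u - v))\<^sup>2 + 2 * (k\<^sup>2 / \<alpha>) * (m * (u - v)) + m\<^sup>2"
      by (simp add: power2_sum algebra_simps)
    then have "m\<^sup>2 \<le> (k\<^sup>2 / \<alpha> * (u - v) + m)\<^sup>2"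
      using mult_nonneg_nonneg[OF c me] by simp
    then show ?thesis unfolding eq by (simp add: abs_le_square_iff)
  qed
  also have "\<bar>k * (\<rho> - w)\<bar> \<le> k * (\<bar>\<rho>\<bar> + \<bar>w\<bar>)"
    using k by (simp add: abs_mult)
  finally have m_le: "\<bar>m\<bar> \<le> k * (\<bar>\<rho>\<bar> + \<bar>w\<bar>)" .
  have q1: "q - 1 = 1 / (p - 1)" using p q by (simp add: field_simps)
  have bound: "\<bar>y\<bar> \<le> (X / a) powr (q - 1)" if "\<bar>a * signed_powr (p - 1) y\<bar> \<le> X" for y
  proof -
    have "\<bar>y\<bar> powr (p - 1) \<le> X / a"
      using that a by (simp add: abs_mult abs_signed_powr field_simps)
    then have "(\<bar>y\<bar> powr (p - 1)) powr (q - 1) \<le> (X / a) powr (q - 1)"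
      using p by (intro powr_mono2) (auto simp: q1)
    then show ?thesis using p by (simp add: powr_powr q1)
  qed
  have "\<bar>u\<bar> \<le> (X / a) powr (q - 1)"
  proof (rule bound)
    have "a * signed_powr (p - 1) u = m + k * w" using v by (simp add: m algebra_simps)
    then have "\<bar>a * signed_powr (p - 1) u\<bar> \<le> \<bar>m\<bar> + k * \<bar>w\<bar>" using k by (metis abs_mult abs_of_pos abs_triangle_ineq)
    then show "\<bar>a * signed_powr (p - 1) u\<bar> \<le> X" using m_le by (simp add: X_def algebra_simps)
  qed
  moreover have "\<bar>v\<bar> \<le> (X / a) powr (q - 1)"
    by (rule bound) (use k in \<open>simp add: v X_def abs_mult\<close>)
  ultimately have "\<bar>u - v\<bar> \<le> 2 * (X / a) powr (q - 1)" by linarith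
  moreover have "\<bar>m\<bar> \<le> X"
  proof (rule order_trans[OF m_le])
    show "k * (\<bar>\<rho>\<bar> + \<bar>w\<bar>) \<le> X" unfolding X_def using k by (intro mult_left_mono) auto
  qed
  ultimately have "\<bar>m\<bar> * \<bar>u - v\<bar> \<le> X * (2 * (X / a) powr (q - 1))"
    using X by (intro mult_mono) auto
  also have "\<dots> = 2 * X powr q * a powr (1 - q)"
  proof (cases "X = 0")
    case False
    then have "X powr q = X * X powr (q - 1)" using X by (simp add: powr_diff)
    moreover have "a powr (1 - q) = inverse (a powr (q - 1))" by (simp add: powr_minus[symmetric])
    moreover have "(X / a) powr (q - 1) = X powr (q - 1) / a powr (q - 1)"
      using X a by (simp add: powr_divide)
    ultimately show ?thesis by (simp add: divide_inverse)
  qed simp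
  finally have "\<bar>m * (u - v)\<bar> \<le> 2 * X powr q * a powr (1 - q)" by (simp add: abs_mult)
  then show ?thesis unfolding X_def by linarith
qed

section \<open>One-coordinate perturbations of the penalty and of the functional\<close>

lemma infsum_change_one:
  fixes f g :: "'b \<Rightarrow> real"
  assumes f: "f summable_on A" and j: "j \<in> A" and eq: "\<And>x. x \<in> A - {j} \<Longrightarrow> g x = f x"
  shows "g summable_on A" "infsum g A = infsum f A + (g j - f j)"
proof -
  have "((\<lambda>x. if x = j then g j - f j else 0) has_sum (g j - f j)) A"
    by (rule has_sum_finite_neutralI[where B = "{j}"]) (use j in auto)
  from has_sum_add[OF has_sum_infsum[OF f] this]
  have "((\<lambda>x. f x + (if x = j then g j - f j else 0)) has_sum (infsum f A + (g j - f j))) A" .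
  moreover have "(\<lambda>x. f x + (if x = j then g j - f j else 0)) x = g x" if "x \<in> A" for x
    using eq[of x] that by auto
  ultimately have "(g has_sum (infsum f A + (g j - f j))) A"
    using has_sum_cong by (metis (no_types, lifting))
  then show "g summable_on A" "infsum g A = infsum f A + (g j - f j)"
    by (auto simp: summable_on_def intro: infsumI)
qed

definition besov_weight :: "real \<Rightarrow> real \<Rightarrow> nat \<Rightarrow> real" where
  "besov_weight p s l = real l powr (p * (s + 1/2) - 1)"

lemma besov_penalty_finite:
  assumes "in_besov \<psi> p s u" "p \<noteq> 0"
  shows "besov_penalty \<psi> p s u =
    ereal (1 / p * (\<Sum>\<^sub>\<infinity>l\<in>{1..}. besov_weight p s l * \<bar>inner u (\<psi> l)\<bar> powr p))"
proof -
  have "0 \<le> (\<Sum>\<^sub>\<infinity>l\<in>{1..}. real l powr (p * (s + 1/2) - 1) * \<bar>inner u (\<psi> l)\<bar> powr p)"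
    by (rule infsum_nonneg) simp
  then show ?thesis
    using assms by (simp add: besov_penalty_def besov_norm_def besov_weight_def powr_powr)
qed

lemma inner_coordinate_shift:
  assumes "orthonormal_basis \<psi>" "l \<ge> 1" "m \<ge> 1"
  shows "inner (u + \<tau> *\<^sub>R \<psi> l) (\<psi> m) = inner u (\<psi> m) + (if m = l then \<tau> else 0)"
  using assms by (auto simp: orthonormal_basis_def inner_add_left)

lemma besov_penalty_shift:
  assumes psi: "orthonormal_basis \<psi>" and u: "in_besov \<psi> p s u" and l: "l \<ge> 1" and p: "p \<noteq> 0"
  shows "besov_penalty \<psi> p s (u + \<tau> *\<^sub>R \<psi> l) = besov_penalty \<psi> p s u +
    ereal (besov_weight p s l / p * (\<bar>inner u (\<psi> l) + \<tau>\<bar> powr p - \<bar>inner u (\<psi> l)\<bar> powr p))"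
proof -
  let ?f = "\<lambda>u m. besov_weight p s m * \<bar>inner u (\<psi> m)\<bar> powr p"
  let ?u' = "u + \<tau> *\<^sub>R \<psi> l"
  have f: "?f u summable_on {1..}" using u by (simp add: in_besov_def besov_weight_def)
  have eq: "?f ?u' m = ?f u m" if "m \<in> {1..} - {l}" for m
    using that l by (simp add: inner_coordinate_shift[OF psi])
  note change = infsum_change_one[where f = "?f u" and g = "?f ?u'" and j = l, OF f _ eq]
  have "in_besov \<psi> p s ?u'"
    using change(1) l by (simp add: in_besov_def besov_weight_def)
  moreover have "infsum (?f ?u') {1..} = infsum (?f u) {1..} + (?f ?u' l - ?f u l)"
    using change(2) l by simp
  ultimately show ?thesis
    using u p l by (simp add: besov_penalty_finite inner_coordinate_shift[OF psi] field_simps)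
qed

lemma besov_subdifferential_domain:
  assumes "\<mu> \<in> subdifferential (besov_penalty \<psi> p s) u"
  shows "in_besov \<psi> p s u"
  using assms by (auto simp: subdifferential_def besov_penalty_def split: if_splits)

text \<open>Along the line through $u$ in direction $\psi_l$ only one term of the penalty varies, and the
  subgradient inequality says that a differentiable function of one real variable is minimal at 0.\<close>

lemma besov_subdifferential_coordinate:
  assumes psi: "orthonormal_basis \<psi>" and p: "p > 1" and l: "l \<ge> 1"
    and \<mu>: "\<mu> \<in> subdifferential (besov_penalty \<psi> p s) u"
  shows "inner \<mu> (\<psi> l) = besov_weight p s l * signed_powr (p - 1) (inner u (\<psi> l))"
proof -
  let ?c = "inner u (\<psi> l)" and ?a = "besov_weight p s l"
  have u: "in_besov \<psi> p s u" by (rule besov_subdifferential_domain[OF \<mu>])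
  then obtain r where r: "besov_penalty \<psi> p s u = ereal r" using besov_penalty_finite p by fastforce
  define h where "h \<tau> = ?a / p * \<bar>?c + \<tau>\<bar> powr p - \<tau> * inner \<mu> (\<psi> l)" for \<tau>
  have "h 0 \<le> h \<tau>" for \<tau>
  proof -
    have "besov_penalty \<psi> p s u + ereal (inner \<mu> (\<tau> *\<^sub>R \<psi> l)) \<le> besov_penalty \<psi> p s (u + \<tau> *\<^sub>R \<psi> l)"
      using \<mu> unfolding subdifferential_def by (metis (mono_tags, lifting) mem_Collect_eq add_diff_cancel_left')
    then show ?thesis
      using p by (simp add: besov_penalty_shift[OF psi u l] r h_def algebra_simps)
  qed
  moreover have "(h has_real_derivative ?a / p * (p * signed_powr (p - 1) (?c + 0)) - inner \<mu> (\<psi> l)) (at 0)"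
    unfolding h_def
    by (rule derivative_eq_intros DERIV_chain2[OF abs_powr_has_derivative[OF p]] refl | simp)+
  ultimately have "?a / p * (p * signed_powr (p - 1) (?c + 0)) - inner \<mu> (\<psi> l) = 0"
    by (intro DERIV_local_min[of h _ 0 1]) auto
  then show ?thesis using p by simp
qed

text \<open>The summability hypothesis makes the pairing with the data a convergent series, so that its
  increment in direction $\psi_l$ is a single term; the functional is then a differentiable function of
  the increment, with its minimum at 0.\<close>

lemma tikhonov_euler_coordinate:
  assumes psi: "orthonormal_basis \<psi>" and p: "p > 1" and l: "l \<ge> 1" and K: "bounded_linear K"
    and K_psi: "K (\<psi> l) = k *\<^sub>R \<psi> l"
    and u: "in_besov \<psi> p s u"
    and F: "(\<lambda>m. inner (K u) (\<psi> m) * F m) summable_on {1..}"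
    and min: "\<And>v. tikhonov \<psi> K (besov_penalty \<psi> p s) \<alpha> F u \<le> tikhonov \<psi> K (besov_penalty \<psi> p s) \<alpha> F v"
  shows "k * (inner (K u) (\<psi> l) - F l) + \<alpha> * (besov_weight p s l * signed_powr (p - 1) (inner u (\<psi> l))) = 0"
proof -
  let ?c = "inner u (\<psi> l)" and ?a = "besov_weight p s l" and ?b = "inner (K u) (\<psi> l)"
  interpret K: bounded_linear K by (rule K)
  obtain r where r: "besov_penalty \<psi> p s u = ereal r" using besov_penalty_finite p u by fastforce
  have Ku: "K (u + \<tau> *\<^sub>R \<psi> l) = K u + (\<tau> * k) *\<^sub>R \<psi> l" for \<tau>
    by (simp add: K.add K.scaleR K_psi)
  have psi1: "inner (\<psi> l) (\<psi> l) = 1" using psi l by (simp add: orthonormal_basis_def)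
  have norm: "(norm (K (u + \<tau> *\<^sub>R \<psi> l)))\<^sup>2 = (norm (K u))\<^sup>2 + 2 * (\<tau> * k) * ?b + (\<tau> * k)\<^sup>2" for \<tau>
    unfolding Ku by (simp add: psi1 power2_norm_eq_inner inner_add_left inner_add_right inner_commute[of "\<psi> l" "K u"]
          power2_eq_square[of \<tau>] power2_eq_square[of k] algebra_simps)
  have pair: "dual_pairing \<psi> (K (u + \<tau> *\<^sub>R \<psi> l)) F = dual_pairing \<psi> (K u) F + \<tau> * k * F l" for \<tau>
  proof -
    have "(\<Sum>\<^sub>\<infinity>m\<in>{1..}. inner (K (u + \<tau> *\<^sub>R \<psi> l)) (\<psi> m) * F m) =
      (\<Sum>\<^sub>\<infinity>m\<in>{1..}. inner (K u) (\<psi> m) * F m) +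
      (inner (K (u + \<tau> *\<^sub>R \<psi> l)) (\<psi> l) * F l - inner (K u) (\<psi> l) * F l)"
      by (rule infsum_change_one(2)[where f = "\<lambda>m. inner (K u) (\<psi> m) * F m"
            and g = "\<lambda>m. inner (K (u + \<tau> *\<^sub>R \<psi> l)) (\<psi> m) * F m", OF F]) (use l in \<open>auto simp: Ku inner_coordinate_shift[OF psi]\<close>)
    then show ?thesis
      using l by (simp add: psi1 dual_pairing_def Ku inner_coordinate_shift[OF psi] algebra_simps)
  qed
  have d1: "((\<lambda>\<tau>. \<bar>?c + \<tau>\<bar> powr p) has_real_derivative p * signed_powr (p - 1) (?c + 0)) (at 0)"
    using abs_powr_has_derivative[OF p, of "?c + 0"] DERIV_shift[of "\<lambda>x. \<bar>x\<bar> powr p" _ 0 ?c]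
    by (simp add: add.commute)
  define h where "h \<tau> = \<tau> * k * (?b - F l) + (\<tau> * k)\<^sup>2 / 2 + \<alpha> * (?a / p * \<bar>?c + \<tau>\<bar> powr p)" for \<tau>
  have "h 0 \<le> h \<tau>" for \<tau>
    using min[of "u + \<tau> *\<^sub>R \<psi> l"] p
    by (simp add: tikhonov_def norm pair besov_penalty_shift[OF psi u l] r h_def algebra_simps)
  moreover have "(h has_real_derivative k * (?b - F l) + \<alpha> * (?a / p * (p * signed_powr (p - 1) (?c + 0)))) (at 0)"
    unfolding h_def
    by (rule d1 derivative_eq_intros refl | simp)+
  ultimately have "k * (?b - F l) + \<alpha> * (?a / p * (p * signed_powr (p - 1) (?c + 0))) = 0"
    by (intro DERIV_local_min[of h _ 0 1]) auto
  then show ?thesis using p by simp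
qed

section \<open>Moments of the noise coefficients\<close>

text \<open>The right-hand side is a crude form of $(2m)!\,\sigma^{2m}/(2^m m!)$ that is also correct for the
  point mass when $m = 0$.\<close>

lemma gaussian_even_moment:
  assumes "prob_space M" and X: "centered_gaussian M X"
  shows "(\<integral>\<^sup>+\<omega>. ennreal (X \<omega> ^ (2 * m)) \<partial>M) \<le>
    ennreal (1 + fact (2 * m) * (LINT \<omega>|M. X \<omega> * X \<omega>) ^ m)"
proof -
  interpret prob_space M by fact
  have nn: "0 \<le> (LINT \<omega>|M. X \<omega> * X \<omega>)" by (rule Bochner_Integration.integral_nonneg) simp
  have [measurable]: "X \<in> borel_measurable M" using X by (simp add: centered_gaussian_def)
  consider "AE \<omega> in M. X \<omega> = 0" |
    \<sigma> where "\<sigma> > 0" "distributed M lborel X (\<lambda>x. ennreal (normal_density 0 \<sigma> x))"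
    using X by (auto simp: centered_gaussian_def)
  then show ?thesis
  proof cases
    case 1
    have "(\<integral>\<^sup>+\<omega>. ennreal (X \<omega> ^ (2 * m)) \<partial>M) \<le> (\<integral>\<^sup>+\<omega>. 1 \<partial>M)"
      by (rule nn_integral_mono_AE, use 1 in eventually_elim) (auto simp: power_0_left)
    also have "\<dots> = ennreal 1" by (simp add: emeasure_space_1)
    also have "\<dots> \<le> ennreal (1 + fact (2 * m) * (LINT \<omega>|M. X \<omega> * X \<omega>) ^ m)"
      using nn by (intro ennreal_leI) simp
    finally show ?thesis .
  next
    case 2
    have moment: "(\<integral>\<^sup>+\<omega>. ennreal (X \<omega> ^ (2 * j)) \<partial>M) =
        ennreal (fact (2 * j) / ((2 / \<sigma>\<^sup>2) ^ j * fact j))" for j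
    proof -
      have "(\<integral>\<^sup>+\<omega>. ennreal (X \<omega> ^ (2 * j)) \<partial>M) =
          (\<integral>\<^sup>+x. ennreal (normal_density 0 \<sigma> x) * ennreal (x ^ (2 * j)) \<partial>lborel)"
        by (subst distributed_nn_integral[OF 2(2), symmetric]) auto
      also have "\<dots> = (\<integral>\<^sup>+x. ennreal (normal_density 0 \<sigma> x * (x - 0) ^ (2 * j)) \<partial>lborel)"
        by (intro nn_integral_cong) (simp add: ennreal_mult' power_mult)
      also have "\<dots> = ennreal (fact (2 * j) / ((2 / \<sigma>\<^sup>2) ^ j * fact j))"
        using normal_moment_even[OF 2(1), of 0 j]
        by (intro nn_integral_eq_integral[THEN trans])
           (auto simp: has_bochner_integral_iff power_mult)
      finally show ?thesis .
    qed
    have "(LINT \<omega>|M. X \<omega> * X \<omega>) = \<sigma>\<^sup>2"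
    proof (rule integral_eq_nn_integral[THEN trans])
      show "enn2real (\<integral>\<^sup>+\<omega>. ennreal (X \<omega> * X \<omega>) \<partial>M) = \<sigma>\<^sup>2"
        using moment[of 1] by (simp add: power2_eq_square)
    qed auto
    moreover have "fact (2 * m) / ((2 / \<sigma>\<^sup>2) ^ m * fact m) \<le> 1 + fact (2 * m) * (\<sigma>\<^sup>2) ^ m"
    proof -
      have "(1::real) \<le> 2 ^ m * fact m"
        using mult_mono[of 1 "2 ^ m" 1 "fact m :: real"] by simp
      then have "fact (2 * m) * (\<sigma>\<^sup>2) ^ m * 1 \<le> fact (2 * m) * (\<sigma>\<^sup>2) ^ m * (2 ^ m * fact m)"
        by (intro mult_left_mono) auto
      then have "fact (2 * m) * (\<sigma>\<^sup>2) ^ m / (2 ^ m * fact m) \<le> fact (2 * m) * (\<sigma>\<^sup>2) ^ m"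
        by (simp add: pos_divide_le_eq)
      then show ?thesis by (simp add: power_divide)
    qed
    ultimately show ?thesis unfolding moment by (intro ennreal_leI) simp
  qed
qed

text \<open>A subsequence converges almost everywhere, and Fatou's lemma applies to it.\<close>

lemma nn_integral_Fatou_L2:
  assumes X: "\<And>n. X n \<in> borel_measurable M" and Z: "Z \<in> borel_measurable M"
    and "finite_measure M"
    and L2: "(\<lambda>n. \<integral>\<^sup>+\<omega>. ennreal ((X n \<omega> - Z \<omega>)\<^sup>2) \<partial>M) \<longlonglongrightarrow> 0"
    and bound: "\<forall>\<^sub>F n in sequentially. (\<integral>\<^sup>+\<omega>. ennreal (X n \<omega> ^ (2 * m)) \<partial>M) \<le> C"
  shows "(\<integral>\<^sup>+\<omega>. ennreal (Z \<omega> ^ (2 * m)) \<partial>M) \<le> C"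
proof -
  note [measurable] = X Z
  have "\<forall>\<^sub>F n in sequentially. (\<integral>\<^sup>+\<omega>. ennreal ((X n \<omega> - Z \<omega>)\<^sup>2) \<partial>M) < 1"
    using L2 by (rule order_tendstoD) simp
  with bound have "\<forall>\<^sub>F n in sequentially. (\<integral>\<^sup>+\<omega>. ennreal (X n \<omega> ^ (2 * m)) \<partial>M) \<le> C \<and>
      (\<integral>\<^sup>+\<omega>. ennreal ((X n \<omega> - Z \<omega>)\<^sup>2) \<partial>M) < 1"
    by eventually_elim simp
  then obtain n0 where n0: "\<And>n. n \<ge> n0 \<Longrightarrow> (\<integral>\<^sup>+\<omega>. ennreal (X n \<omega> ^ (2 * m)) \<partial>M) \<le> C"
    "\<And>n. n \<ge> n0 \<Longrightarrow> (\<integral>\<^sup>+\<omega>. ennreal ((X n \<omega> - Z \<omega>)\<^sup>2) \<partial>M) < 1"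
    by (auto simp: eventually_at_top_linorder)
  \<comment> \<open>the shift discards the indices at which the integrals may be infinite\<close>
  define Y where "Y n = X (n + n0)" for n
  have [measurable]: "Y n \<in> borel_measurable M" for n by (simp add: Y_def)
  have int: "integrable M (\<lambda>\<omega>. (Y n \<omega> - Z \<omega>)\<^sup>2)" for n
    using n0(2)[of "n + n0"] by (intro integrableI_bounded) (auto simp: Y_def intro: less_trans)
  have "(\<lambda>n. \<integral>\<omega>. norm ((Y n \<omega> - Z \<omega>)\<^sup>2) \<partial>M) \<longlonglongrightarrow> 0"
  proof -
    have "ennreal (\<integral>\<omega>. norm ((Y n \<omega> - Z \<omega>)\<^sup>2) \<partial>M) = (\<integral>\<^sup>+\<omega>. ennreal ((X (n + n0) \<omega> - Z \<omega>)\<^sup>2) \<partial>M)" for n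
      using int[of n] by (subst nn_integral_eq_integral[symmetric]) (auto simp: Y_def)
    then have "(\<lambda>n. ennreal (\<integral>\<omega>. norm ((Y n \<omega> - Z \<omega>)\<^sup>2) \<partial>M)) \<longlonglongrightarrow> ennreal 0"
      using LIMSEQ_ignore_initial_segment[OF L2, of n0] by simp
    then show ?thesis by (subst (asm) tendsto_ennreal_iff) auto
  qed
  from tendsto_L1_AE_subseq[OF int this] obtain r where r: "strict_mono r"
    "AE \<omega> in M. (\<lambda>n. (Y (r n) \<omega> - Z \<omega>)\<^sup>2) \<longlonglongrightarrow> 0" by auto
  have "(\<integral>\<^sup>+\<omega>. ennreal (Z \<omega> ^ (2 * m)) \<partial>M) = (\<integral>\<^sup>+\<omega>. liminf (\<lambda>n. ennreal (Y (r n) \<omega> ^ (2 * m))) \<partial>M)"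
  proof (rule nn_integral_cong_AE, use r(2) in eventually_elim)
    case (elim \<omega>)
    then have "(\<lambda>n. Y (r n) \<omega> - Z \<omega>) \<longlonglongrightarrow> 0"
      using tendsto_real_sqrt[OF elim] by (simp add: tendsto_rabs_zero_iff)
    then have "(\<lambda>n. ennreal (Y (r n) \<omega> ^ (2 * m))) \<longlonglongrightarrow> ennreal (Z \<omega> ^ (2 * m))"
      by (intro tendsto_ennrealI tendsto_power) (simp add: LIM_zero_iff)
    then show ?case by (rule lim_imp_Liminf[OF trivial_limit_sequentially, symmetric])
  qed
  also have "\<dots> \<le> liminf (\<lambda>n. \<integral>\<^sup>+\<omega>. ennreal (Y (r n) \<omega> ^ (2 * m)) \<partial>M)"
    by (rule nn_integral_liminf) simp
  also have "\<dots> \<le> C"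
    by (rule Liminf_le) (auto simp: Y_def intro!: n0(1) always_eventually)
  finally show ?thesis .
qed

text \<open>The approximating pairings with test functions are Gaussian with variances converging to
  $\|f\|^2 = 1$, hence eventually below 2.\<close>

lemma noise_pairing_even_moment:
  assumes M: "prob_space M" and N: "white_noise M N" and Z: "noise_pairing M N f Z"
    and f: "norm f = 1"
  shows "(\<integral>\<^sup>+\<omega>. ennreal (Z \<omega> ^ (2 * m)) \<partial>M) \<le> ennreal (1 + fact (2 * m) * 2 ^ m)"
proof -
  interpret prob_space M by fact
  from Z obtain \<phi> where \<phi>: "\<And>n. test_function (\<phi> n)" "(\<lambda>n. abs_l2_torus (\<phi> n)) \<longlonglongrightarrow> f"
    "(\<lambda>n. \<integral>\<^sup>+\<omega>. ennreal ((N \<omega> (\<phi> n) - Z \<omega>)\<^sup>2) \<partial>M) \<longlonglongrightarrow> 0"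
    by (auto simp: noise_pairing_def)
  have gauss: "centered_gaussian M (\<lambda>\<omega>. N \<omega> (\<phi> n))" for n
    using N \<phi>(1) by (simp add: white_noise_def)
  show ?thesis
  proof (rule nn_integral_Fatou_L2[OF _ _ _ \<phi>(3)])
    have "(\<lambda>n. inner (abs_l2_torus (\<phi> n)) (abs_l2_torus (\<phi> n))) \<longlonglongrightarrow> inner f f"
      by (intro tendsto_inner \<phi>(2))
    then have "\<forall>\<^sub>F n in sequentially. inner (abs_l2_torus (\<phi> n)) (abs_l2_torus (\<phi> n)) < 2"
      by (rule order_tendstoD) (simp add: dot_square_norm f)
    then show "\<forall>\<^sub>F n in sequentially. (\<integral>\<^sup>+\<omega>. ennreal (N \<omega> (\<phi> n) ^ (2 * m)) \<partial>M) \<le>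
      ennreal (1 + fact (2 * m) * 2 ^ m)"
    proof eventually_elim
      case (elim n)
      have "(LINT \<omega>|M. N \<omega> (\<phi> n) * N \<omega> (\<phi> n)) = inner (abs_l2_torus (\<phi> n)) (abs_l2_torus (\<phi> n))"
        using N \<phi>(1) by (simp add: white_noise_def)
      with elim show ?case
        by (intro order_trans[OF gaussian_even_moment[OF M gauss]] ennreal_leI add_left_mono
            mult_left_mono power_mono) auto
    qed
  qed (use gauss Z in \<open>auto simp: centered_gaussian_def noise_pairing_def finite_measure_axioms\<close>)
qed

lemma powr_le_one_plus_even_power:
  fixes x q :: real
  assumes "0 \<le> q" "q \<le> 2 * real m"
  shows "\<bar>x\<bar> powr q \<le> 1 + x ^ (2 * m)"
proof (cases "\<bar>x\<bar> \<le> 1")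
  case True
  then have "\<bar>x\<bar> powr q \<le> 1 powr q" using assms by (intro powr_mono2) auto
  then show ?thesis by (simp add: power_mult add_increasing2)
next
  case False
  then have "\<bar>x\<bar> powr q \<le> \<bar>x\<bar> powr real (2 * m)" using assms by (intro powr_mono) auto
  also have "\<dots> = x ^ (2 * m)" using False by (simp add: powr_realpow power_even_abs del: of_nat_mult)
  finally show ?thesis by simp
qed

text \<open>The constant depends on the exponent alone. It is the same for all unit vectors, which is
  what the sums over all frequencies require.\<close>

lemma white_noise_coefficient_moment_bound:
  assumes M: "prob_space M" and N: "white_noise M N" and q: "q \<ge> 0"
  obtains C where "C \<ge> 0"
    "\<And>f Z. norm f = 1 \<Longrightarrow> noise_pairing M N f Z \<Longrightarrow>
       (\<integral>\<^sup>+\<omega>. ennreal (\<bar>Z \<omega>\<bar> powr q) \<partial>M) \<le> ennreal C"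
proof -
  interpret prob_space M by fact
  obtain m where m: "q \<le> real m" using real_arch_simple by blast
  define C :: real where "C = 2 + fact (2 * m) * 2 ^ m"
  show ?thesis
  proof (rule that)
    show "C \<ge> 0" by (simp add: C_def)
    fix f Z assume f: "norm f = 1" and Z: "noise_pairing M N f Z"
    have [measurable]: "Z \<in> borel_measurable M" using Z by (simp add: noise_pairing_def)
    have "(\<integral>\<^sup>+\<omega>. ennreal (\<bar>Z \<omega>\<bar> powr q) \<partial>M) \<le> (\<integral>\<^sup>+\<omega>. 1 + ennreal (Z \<omega> ^ (2 * m)) \<partial>M)"
    proof (rule nn_integral_mono)
      fix \<omega>
      have "ennreal (\<bar>Z \<omega>\<bar> powr q) \<le> ennreal (1 + Z \<omega> ^ (2 * m))"
        using m q by (intro ennreal_leI powr_le_one_plus_even_power) auto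
      then show "ennreal (\<bar>Z \<omega>\<bar> powr q) \<le> 1 + ennreal (Z \<omega> ^ (2 * m))"
        by (simp add: power_mult)
    qed
    also have "\<dots> = 1 + (\<integral>\<^sup>+\<omega>. ennreal (Z \<omega> ^ (2 * m)) \<partial>M)"
      by (subst nn_integral_add) (auto simp: emeasure_space_1)
    also have "\<dots> \<le> 1 + ennreal (1 + fact (2 * m) * 2 ^ m)"
      by (intro add_left_mono noise_pairing_even_moment[OF M N Z f])
    also have "\<dots> = ennreal C"
      by (simp add: C_def ennreal_plus[symmetric] ennreal_1[symmetric] del: ennreal_plus ennreal_1)
    finally show "(\<integral>\<^sup>+\<omega>. ennreal (\<bar>Z \<omega>\<bar> powr q) \<partial>M) \<le> ennreal C" .
  qed
qed

section \<open>Integration of series of random variables\<close>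

lemma AE_summable_of_nn_integral:
  fixes T :: "nat \<Rightarrow> 'w \<Rightarrow> real"
  assumes T: "\<And>i. T i \<in> borel_measurable M" and nn: "\<And>i \<omega>. 0 \<le> T i \<omega>"
    and b: "\<And>i. (\<integral>\<^sup>+\<omega>. ennreal (T i \<omega>) \<partial>M) \<le> ennreal (b i)" "\<And>i. 0 \<le> b i" "summable b"
  shows "AE \<omega> in M. summable (\<lambda>i. T i \<omega>)"
proof -
  note [measurable] = T
  have "(\<integral>\<^sup>+\<omega>. (\<Sum>i. ennreal (T i \<omega>)) \<partial>M) = (\<Sum>i. \<integral>\<^sup>+\<omega>. ennreal (T i \<omega>) \<partial>M)"
    by (rule nn_integral_suminf) simp
  also have "\<dots> \<le> (\<Sum>i. ennreal (b i))"
    by (intro suminf_le b) auto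
  also have "\<dots> = ennreal (\<Sum>i. b i)"
    by (rule suminf_ennreal2) (use b in auto)
  finally have "(\<integral>\<^sup>+\<omega>. (\<Sum>i. ennreal (T i \<omega>)) \<partial>M) \<noteq> \<infinity>"
    by (auto simp: top_unique)
  then have "AE \<omega> in M. (\<Sum>i. ennreal (T i \<omega>)) \<noteq> \<infinity>"
    by (intro nn_integral_PInf_AE) auto
  then show ?thesis
    by eventually_elim (auto intro: summable_suminf_not_top nn)
qed

text \<open>The function $D$ is known only almost everywhere, hence the completion. Its integral is computed
  term by term from the measurable summands.\<close>

lemma integrable_completion_sums:
  fixes T :: "nat \<Rightarrow> 'w \<Rightarrow> real"
  assumes T: "\<And>i. T i \<in> borel_measurable M" and nn: "AE \<omega> in M. \<forall>i. 0 \<le> T i \<omega>"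
    and D: "AE \<omega> in M. (\<lambda>i. T i \<omega>) sums D \<omega>"
    and b: "\<And>i. (\<integral>\<^sup>+\<omega>. ennreal (T i \<omega>) \<partial>M) \<le> ennreal (b i)" "\<And>i. 0 \<le> b i" "summable b"
  shows "integrable (completion M) D" and "0 \<le> (LINT \<omega>|completion M. D \<omega>)"
    and "(LINT \<omega>|completion M. D \<omega>) \<le> (\<Sum>i. b i)"
proof -
  note [measurable] = T
  define D' where "D' \<omega> = (\<Sum>i. T i \<omega>)" for \<omega>
  have D': "D' \<in> borel_measurable M" unfolding D'_def by measurable
  have eq: "AE \<omega> in M. D \<omega> = D' \<omega>"
    using D by eventually_elim (simp add: D'_def sums_unique)
  have meas: "D \<in> borel_measurable (completion M)"
  proof (rule measurableI)
    fix S :: "real set" assume S: "S \<in> sets borel"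
    show "D -` S \<inter> space (completion M) \<in> sets (completion M)"
    proof (rule completion.in_sets_AE)
      show "AE \<omega> in completion M. \<omega> \<in> D' -` S \<inter> space M \<longleftrightarrow> \<omega> \<in> D -` S \<inter> space (completion M)"
        by (rule AE_completion, use eq in eventually_elim) auto
      show "D' -` S \<inter> space M \<in> sets (completion M)"
        using measurable_sets[OF D' S] by auto
    qed auto
  qed auto
  have D_nn: "AE \<omega> in completion M. 0 \<le> D \<omega>"
  proof (rule AE_completion, use D nn in eventually_elim)
    case (elim \<omega>)
    then show ?case using sums_le[of "\<lambda>_. 0" "\<lambda>i. T i \<omega>" 0 "D \<omega>"] by simp
  qed
  have "(\<integral>\<^sup>+\<omega>. ennreal (D \<omega>) \<partial>completion M) = (\<integral>\<^sup>+\<omega>. (\<Sum>i. ennreal (T i \<omega>)) \<partial>M)"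
    unfolding nn_integral_completion
  proof (rule nn_integral_cong_AE, use D nn in eventually_elim)
    case (elim \<omega>)
    then show ?case by (subst suminf_ennreal2) (auto simp: sums_iff)
  qed
  also have "\<dots> = (\<Sum>i. \<integral>\<^sup>+\<omega>. ennreal (T i \<omega>) \<partial>M)"
    by (rule nn_integral_suminf) simp
  also have "\<dots> \<le> (\<Sum>i. ennreal (b i))"
    by (intro suminf_le b) auto
  also have "\<dots> = ennreal (\<Sum>i. b i)"
    by (rule suminf_ennreal2) (use b in auto)
  finally have le: "(\<integral>\<^sup>+\<omega>. ennreal (D \<omega>) \<partial>completion M) \<le> ennreal (\<Sum>i. b i)" .
  show int: "integrable (completion M) D"
    by (rule integrableI_nonneg[OF meas D_nn]) (use le in \<open>auto intro: le_less_trans\<close>)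
  show "0 \<le> (LINT \<omega>|completion M. D \<omega>)" by (rule integral_nonneg_AE[OF D_nn])
  have "0 \<le> (\<Sum>i. b i)" using b by (intro suminf_nonneg) auto
  then show "(LINT \<omega>|completion M. D \<omega>) \<le> (\<Sum>i. b i)"
    using le unfolding nn_integral_eq_integral[OF int D_nn] by (simp add: ennreal_le_iff)
qed

text \<open>The left inverse $y \mapsto \sup\{x \mid G(x) \le y\}$ is monotone, hence Borel.\<close>

lemma strict_mono_inverse_measurable:
  fixes G :: "real \<Rightarrow> real"
  assumes mono: "\<And>x y. x < y \<Longrightarrow> G x < G y"
    and above: "\<And>y. \<exists>x. y < G x" and below: "\<And>y. \<exists>x. G x < y"
  obtains g where "g \<in> borel_measurable borel" "\<And>x. g (G x) = x"
proof
  define g where "g y = Sup {x. G x \<le> y}" for y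
  have le_iff: "G x \<le> G y \<longleftrightarrow> x \<le> y" for x y
    using mono[of x y] mono[of y x] by (cases x y rule: linorder_cases) auto
  show "g (G x) = x" for x
    using cSup_atMost[of x] by (simp add: g_def le_iff atMost_def)
  have "mono g"
  proof (rule monoI)
    fix y z :: real assume "y \<le> z"
    obtain b where b: "G b < y" using below by blast
    obtain c where c: "z < G c" using above by blast
    have "bdd_above {x. G x \<le> z}"
    proof (rule bdd_aboveI)
      fix x assume "x \<in> {x. G x \<le> z}"
      then show "x \<le> c" using c le_iff[of x c] by simp
    qed
    then show "g y \<le> g z"
      unfolding g_def using b \<open>y \<le> z\<close> by (intro cSup_subset_mono) (auto intro: less_imp_le)
  qed
  then show "g \<in> borel_measurable borel" by (rule borel_measurable_mono)
qed

text \<open>This exhibits the coordinates of a minimizer, which are given only as solutions of the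
  optimality equation, as measurable functions of the noise coefficients.\<close>

lemma diagonal_resolvent_measurable:
  assumes p: "p > 1" and c: "c > 0" and a: "a > 0"
  obtains g where "g \<in> borel_measurable borel" "\<And>x y. c * x + a * signed_powr (p - 1) x = y \<Longrightarrow> g y = x"
proof -
  have sgn: "0 \<le> signed_powr (p - 1) x \<longleftrightarrow> 0 \<le> x" for x
    by (auto simp: signed_powr_def zero_le_mult_iff sgn_if)
  show ?thesis
  proof (rule strict_mono_inverse_measurable[of "\<lambda>x. c * x + a * signed_powr (p - 1) x"])
    show "c * x + a * signed_powr (p - 1) x < c * y + a * signed_powr (p - 1) y" if "x < y" for x y
      using that p c a signed_powr_strict_mono[of "p - 1" x y] by (intro add_strict_mono mult_strict_left_mono) auto
    show "\<exists>x. y < c * x + a * signed_powr (p - 1) x" for y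
    proof
      have "0 \<le> signed_powr (p - 1) ((\<bar>y\<bar> + 1) / c)"
        unfolding sgn using c by simp
      then have "y \<le> \<bar>y\<bar> + a * signed_powr (p - 1) ((\<bar>y\<bar> + 1) / c)"
        using a by (intro add_increasing2 mult_nonneg_nonneg) auto
      then show "y < c * ((\<bar>y\<bar> + 1) / c) + a * signed_powr (p - 1) ((\<bar>y\<bar> + 1) / c)"
        using c by simp
    qed
    show "\<exists>x. c * x + a * signed_powr (p - 1) x < y" for y
    proof
      have "signed_powr (p - 1) (- ((\<bar>y\<bar> + 1) / c)) \<le> 0"
        using c by (simp add: signed_powr_def)
      then have "a * signed_powr (p - 1) (- ((\<bar>y\<bar> + 1) / c)) \<le> 0"
        using a by (simp add: mult_le_0_iff)
      then show "c * (- ((\<bar>y\<bar> + 1) / c)) + a * signed_powr (p - 1) (- ((\<bar>y\<bar> + 1) / c)) < y"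
        using c by simp
    qed
  qed (use that in blast)
qed

section \<open>Expected Bregman distance in the sequence model\<close>

text \<open>By the mean value theorem $(\beta - 1)(j+1)^{-\beta} \le j^{1-\beta} - (j+1)^{1-\beta}$, and the
  right-hand sides telescope.\<close>

lemma powr_tail_partial_sum:
  fixes \<beta> :: real
  assumes \<beta>: "\<beta> > 1" and n: "n \<ge> 1"
  shows "(\<Sum>i<j. if n \<le> i then real (Suc i) powr (- \<beta>) else 0) \<le>
    (real n powr (1 - \<beta>) - real (max n j) powr (1 - \<beta>)) / (\<beta> - 1)"
proof (induction j)
  case 0
  then show ?case by simp
next
  case (Suc j)
  show ?case
  proof (cases "n \<le> j")
    case True
    have "\<exists>z. real j < z \<and> z < real j + 1 \<and>
        (real j + 1) powr (1 - \<beta>) - real j powr (1 - \<beta>) = (real j + 1 - real j) * ((1 - \<beta>) * z powr (1 - \<beta> - 1))"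
    proof (rule MVT2)
      show "((\<lambda>x. x powr (1 - \<beta>)) has_real_derivative (1 - \<beta>) * x powr (1 - \<beta> - 1)) (at x)"
        if "real j \<le> x" for x
        by (rule has_real_derivative_powr) (use that True n in auto)
    qed simp
    then obtain z where z: "real j < z" "z < real j + 1"
      "(real j + 1) powr (1 - \<beta>) - real j powr (1 - \<beta>) = (1 - \<beta>) * z powr (- \<beta>)" by auto
    have "(real j + 1) powr (- \<beta>) \<le> z powr (- \<beta>)"
      using z \<beta> by (intro powr_mono2') auto
    then have "(\<beta> - 1) * (real j + 1) powr (- \<beta>) \<le> (\<beta> - 1) * z powr (- \<beta>)"
      using \<beta> by (intro mult_left_mono) auto
    then have "(real j + 1) powr (- \<beta>) \<le> (real j powr (1 - \<beta>) - (real j + 1) powr (1 - \<beta>)) / (\<beta> - 1)"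
      using z(3) \<beta> by (simp add: field_simps)
    then show ?thesis
      using Suc.IH True by (simp add: max_def diff_divide_distrib add.commute)
  next
    case False
    then show ?thesis using Suc.IH by (auto simp: max_def le_Suc_eq)
  qed
qed

lemma powr_tail_sum:
  fixes \<beta> :: real
  assumes \<beta>: "\<beta> > 1" and n: "n \<ge> 1"
  shows "summable (\<lambda>i. if n \<le> i then real (Suc i) powr (- \<beta>) else 0)"
    and "(\<Sum>i. if n \<le> i then real (Suc i) powr (- \<beta>) else 0) \<le> real n powr (1 - \<beta>) / (\<beta> - 1)"
proof -
  have le: "(\<Sum>i<j. if n \<le> i then real (Suc i) powr (- \<beta>) else 0) \<le> real n powr (1 - \<beta>) / (\<beta> - 1)" for j
    using \<beta> by (intro order_trans[OF powr_tail_partial_sum[OF \<beta> n]] divide_right_mono) auto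
  show s: "summable (\<lambda>i. if n \<le> i then real (Suc i) powr (- \<beta>) else 0)"
    by (rule summableI_nonneg_bounded[OF _ le]) auto
  show "(\<Sum>i. if n \<le> i then real (Suc i) powr (- \<beta>) else 0) \<le> real n powr (1 - \<beta>) / (\<beta> - 1)"
    by (rule suminf_le_const[OF s le])
qed

lemma powr_add_le:
  fixes x y q :: real
  assumes "x \<ge> 0" "y \<ge> 0" "q \<ge> 0"
  shows "(x + y) powr q \<le> 2 powr q * (x powr q + y powr q)"
proof -
  have "(x + y) powr q \<le> (2 * max x y) powr q"
    using assms by (intro powr_mono2) auto
  also have "\<dots> = 2 powr q * max x y powr q"
    using assms by (simp add: powr_mult)
  also have "\<dots> \<le> 2 powr q * (x powr q + y powr q)"
    by (intro mult_left_mono) (auto simp: max_def)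
  finally show ?thesis .
qed

text \<open>The cut-off $n$ is free: for $l \le n$ the low-frequency bound is integrated, for $l > n$ the
  high-frequency bound. In the tail the factor $l^{-\beta}$ is summed against the noise, whereas against
  the summable $w_l^2$ it is only estimated by $n^{-\beta}$.\<close>

lemma sequence_model_bregman:
  fixes k a v w :: "nat \<Rightarrow> real" and N u :: "nat \<Rightarrow> 'w \<Rightarrow> real" and D :: "'w \<Rightarrow> real"
  assumes M: "prob_space M"
    and p: "p > 1" and q: "q = p / (p - 1)"
    and \<delta>: "\<delta> > 0" and \<alpha>: "\<alpha> > 0" and k: "\<And>i. k i > 0" and a: "\<And>i. a i > 0"
    and source: "\<And>i. a i * signed_powr (p - 1) (v i) = k i * w i"
    and w: "(\<lambda>i. (w i)\<^sup>2) sums W" "\<And>i. \<bar>w i\<bar> powr q \<le> V * (w i)\<^sup>2" and V: "V \<ge> 0"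
    and N: "\<And>i. N i \<in> borel_measurable M"
    and N2: "\<And>i. (\<integral>\<^sup>+\<omega>. ennreal ((N i \<omega>)\<^sup>2) \<partial>M) \<le> ennreal C"
    and Nq: "\<And>i. (\<integral>\<^sup>+\<omega>. ennreal (\<bar>N i \<omega>\<bar> powr q) \<partial>M) \<le> ennreal C" and C: "C \<ge> 0"
    and decay: "\<And>i. k i powr q * a i powr (1 - q) \<le> A * real (Suc i) powr (- \<beta>)"
    and A: "A \<ge> 0" and \<beta>: "\<beta> > 1"
    and euler: "AE \<omega> in M. \<forall>i. k i * (k i * (u i \<omega> - v i) - \<delta> * N i \<omega>) + \<alpha> * (a i * signed_powr (p - 1) (u i \<omega>)) = 0"
    and D: "AE \<omega> in M. (\<lambda>i. (a i * signed_powr (p - 1) (u i \<omega>) - k i * w i) * (u i \<omega> - v i)) sums D \<omega>"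
  shows "integrable (completion M) D" (is ?int)
    and "0 \<le> (LINT \<omega>|completion M. D \<omega>)" (is ?nonneg)
    and "\<And>n. n \<ge> 1 \<Longrightarrow> (LINT \<omega>|completion M. D \<omega>) \<le>
      \<alpha> / 2 * W + real n * (\<delta>\<^sup>2 / \<alpha> * C) +
      2 * 4 powr q * A * ((\<delta> / \<alpha>) powr q * C * (real n powr (1 - \<beta>) / (\<beta> - 1)) + real n powr (- \<beta>) * V * W)"
      (is "\<And>n. _ \<Longrightarrow> _ \<le> ?bound n")
proof -
  interpret prob_space M by fact
  note [measurable] = N
  have q0: "q > 0" using p q by simp
  have W: "W \<ge> 0" using sums_le[OF _ sums_zero w(1)] by simp
  have "\<exists>g. \<forall>i. g i \<in> borel_measurable borel \<and> (\<forall>x y. (k i)\<^sup>2 * x + \<alpha> * a i * signed_powr (p - 1) x = y \<longrightarrow> g i y = x)"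
  proof (rule choice, intro allI)
    fix i
    show "\<exists>h. h \<in> borel_measurable borel \<and> (\<forall>x y. (k i)\<^sup>2 * x + \<alpha> * a i * signed_powr (p - 1) x = y \<longrightarrow> h y = x)"
      by (rule diagonal_resolvent_measurable[OF p, of "(k i)\<^sup>2" "\<alpha> * a i"])
         (use \<alpha> k[of i] a[of i] in auto)
  qed
  then obtain g where g[measurable]: "\<And>i. g i \<in> borel_measurable borel"
    and g_eq: "\<And>i x y. (k i)\<^sup>2 * x + \<alpha> * a i * signed_powr (p - 1) x = y \<Longrightarrow> g i y = x" by blast
  \<comment> \<open>a measurable version of \<open>u\<close>, which itself is determined by \<open>euler\<close> only almost surely\<close>
  define u' where "u' i \<omega> = g i ((k i)\<^sup>2 * v i + k i * \<delta> * N i \<omega>)" for i \<omega>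
  have u': "AE \<omega> in M. \<forall>i. u' i \<omega> = u i \<omega>"
    using euler
  proof eventually_elim
    case (elim \<omega>)
    show ?case unfolding u'_def
      by (intro allI g_eq) (use elim in \<open>simp add: algebra_simps power2_eq_square\<close>)
  qed
  have [measurable]: "u' i \<in> borel_measurable M" for i unfolding u'_def by measurable
  define T where "T i \<omega> = (a i * signed_powr (p - 1) (u' i \<omega>) - k i * w i) * (u' i \<omega> - v i)" for i \<omega>
  have T_meas: "T i \<in> borel_measurable M" for i unfolding T_def signed_powr_def by measurable
  define m where "m i \<omega> = a i * (signed_powr (p - 1) (u' i \<omega>) - signed_powr (p - 1) (v i))" for i \<omega>
  have T_m: "T i \<omega> = m i \<omega> * (u' i \<omega> - v i)" for i \<omega>
    by (simp add: T_def m_def source right_diff_distrib)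
  have T_nn: "0 \<le> T i \<omega>" for i \<omega>
    using signed_powr_diff_mult_nonneg[of "p - 1" "u' i \<omega>" "v i"] p a[of i] by (simp add: T_m m_def mult.assoc)
  have T_D: "AE \<omega> in M. (\<lambda>i. T i \<omega>) sums D \<omega>"
    using D u' by eventually_elim (simp add: T_def)
  define \<rho> where "\<rho> i \<omega> = \<delta> / \<alpha> * N i \<omega>" for i \<omega>
  have eq: "AE \<omega> in M. (k i)\<^sup>2 / \<alpha> * (u' i \<omega> - v i) + m i \<omega> = k i * (\<rho> i \<omega> - w i)" for i
    using euler u'
  proof eventually_elim
    case (elim \<omega>)
    then have "k i * (k i * (u' i \<omega> - v i) - \<delta> * N i \<omega>) + \<alpha> * (a i * signed_powr (p - 1) (u' i \<omega>)) = 0" by simp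
    moreover have "a i * signed_powr (p - 1) (u' i \<omega>) = m i \<omega> + k i * w i"
      by (simp add: m_def source right_diff_distrib)
    ultimately show ?case using \<alpha> by (simp add: \<rho>_def power2_eq_square field_simps)
  qed
  have low: "(\<integral>\<^sup>+\<omega>. ennreal (T i \<omega>) \<partial>M) \<le> ennreal (\<alpha> / 2 * (w i)\<^sup>2 + \<delta>\<^sup>2 / \<alpha> * C)" for i
  proof -
    have "(\<integral>\<^sup>+\<omega>. ennreal (T i \<omega>) \<partial>M) \<le>
        (\<integral>\<^sup>+\<omega>. ennreal (\<alpha> / 2 * (w i)\<^sup>2) + ennreal (\<delta>\<^sup>2 / \<alpha>) * ennreal ((N i \<omega>)\<^sup>2) \<partial>M)"
    proof (rule nn_integral_mono_AE, use eq[of i] in eventually_elim)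
      case (elim \<omega>)
      have "T i \<omega> \<le> \<alpha> * ((\<rho> i \<omega>)\<^sup>2 + (w i)\<^sup>2) / 2"
        unfolding T_m by (rule coordinate_bregman_low[OF \<alpha> elim])
      also have "\<dots> = \<alpha> / 2 * (w i)\<^sup>2 + \<delta>\<^sup>2 / \<alpha> * (N i \<omega>)\<^sup>2 / 2"
        using \<alpha> by (simp add: \<rho>_def power2_eq_square field_simps)
      also have "\<dots> \<le> \<alpha> / 2 * (w i)\<^sup>2 + \<delta>\<^sup>2 / \<alpha> * (N i \<omega>)\<^sup>2"
      proof -
        have half: "x / 2 \<le> x" if "0 \<le> x" for x :: real using that by simp
        show ?thesis by (intro add_left_mono half) (use \<alpha> in simp)
      qed
      finally have "ennreal (T i \<omega>) \<le> ennreal (\<alpha> / 2 * (w i)\<^sup>2 + \<delta>\<^sup>2 / \<alpha> * (N i \<omega>)\<^sup>2)"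
        by (rule ennreal_leI)
      also have "\<dots> = ennreal (\<alpha> / 2 * (w i)\<^sup>2) + ennreal (\<delta>\<^sup>2 / \<alpha>) * ennreal ((N i \<omega>)\<^sup>2)"
        using \<alpha> by (subst ennreal_plus) (auto simp: ennreal_mult[symmetric])
      finally show ?case .
    qed
    also have "\<dots> = ennreal (\<alpha> / 2 * (w i)\<^sup>2) + ennreal (\<delta>\<^sup>2 / \<alpha>) * (\<integral>\<^sup>+\<omega>. ennreal ((N i \<omega>)\<^sup>2) \<partial>M)"
      by (subst nn_integral_add) (auto simp: nn_integral_cmult emeasure_space_1)
    also have "\<dots> \<le> ennreal (\<alpha> / 2 * (w i)\<^sup>2) + ennreal (\<delta>\<^sup>2 / \<alpha>) * ennreal C"
      by (intro add_left_mono mult_left_mono N2) auto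
    also have "\<dots> = ennreal (\<alpha> / 2 * (w i)\<^sup>2 + \<delta>\<^sup>2 / \<alpha> * C)"
      using \<alpha> C by (subst ennreal_plus) (auto simp: ennreal_mult[symmetric])
    finally show ?thesis .
  qed
  define H where "H i = 2 * 4 powr q * A * real (Suc i) powr (- \<beta>)" for i
  have H: "H i \<ge> 0" for i using A by (simp add: H_def)
  have high: "(\<integral>\<^sup>+\<omega>. ennreal (T i \<omega>) \<partial>M) \<le> ennreal (H i * ((\<delta> / \<alpha>) powr q * C + V * (w i)\<^sup>2))" for i
  proof -
    have "(\<integral>\<^sup>+\<omega>. ennreal (T i \<omega>) \<partial>M) \<le>
        (\<integral>\<^sup>+\<omega>. ennreal (H i * (V * (w i)\<^sup>2)) + ennreal (H i * (\<delta> / \<alpha>) powr q) * ennreal (\<bar>N i \<omega>\<bar> powr q) \<partial>M)"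
    proof (rule nn_integral_mono_AE, use eq[of i] in eventually_elim)
      case (elim \<omega>)
      have "T i \<omega> \<le> 2 * (k i * (\<bar>\<rho> i \<omega>\<bar> + 2 * \<bar>w i\<bar>)) powr q * a i powr (1 - q)"
        unfolding T_m by (rule coordinate_bregman_high[OF p q \<alpha> k a source m_def elim])
      also have "\<dots> = 2 * (k i powr q * a i powr (1 - q)) * (\<bar>\<rho> i \<omega>\<bar> + 2 * \<bar>w i\<bar>) powr q"
        using k[of i] by (simp add: powr_mult)
      also have "\<dots> \<le> 2 * (A * real (Suc i) powr (- \<beta>)) * (4 powr q * (\<bar>\<rho> i \<omega>\<bar> powr q + \<bar>w i\<bar> powr q))"
      proof (rule mult_mono[OF mult_left_mono[OF decay]])
        have "(\<bar>\<rho> i \<omega>\<bar> + 2 * \<bar>w i\<bar>) powr q \<le> (2 * \<bar>\<rho> i \<omega>\<bar> + 2 * \<bar>w i\<bar>) powr q"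
          using q0 by (intro powr_mono2) auto
        also have "\<dots> \<le> 2 powr q * ((2 * \<bar>\<rho> i \<omega>\<bar>) powr q + (2 * \<bar>w i\<bar>) powr q)"
          using q0 by (intro powr_add_le) auto
        also have "\<dots> = (2 powr q * 2 powr q) * (\<bar>\<rho> i \<omega>\<bar> powr q + \<bar>w i\<bar> powr q)"
          by (simp add: powr_mult algebra_simps)
        also have "2 powr q * 2 powr q = (4::real) powr q"
          by (simp add: powr_mult[symmetric])
        finally show "(\<bar>\<rho> i \<omega>\<bar> + 2 * \<bar>w i\<bar>) powr q \<le> 4 powr q * (\<bar>\<rho> i \<omega>\<bar> powr q + \<bar>w i\<bar> powr q)" .
      qed (use A in auto)
      also have "\<dots> = H i * (\<bar>\<rho> i \<omega>\<bar> powr q + \<bar>w i\<bar> powr q)"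
        by (simp add: H_def mult_ac)
      also have "\<dots> \<le> H i * (\<bar>\<rho> i \<omega>\<bar> powr q + V * (w i)\<^sup>2)"
        by (intro mult_left_mono add_left_mono w H)
      also have "\<dots> = H i * (V * (w i)\<^sup>2) + H i * (\<delta> / \<alpha>) powr q * \<bar>N i \<omega>\<bar> powr q"
      proof -
        have "\<bar>\<rho> i \<omega>\<bar> = \<delta> / \<alpha> * \<bar>N i \<omega>\<bar>"
          using \<delta> \<alpha> by (simp add: \<rho>_def abs_mult)
        then have "\<bar>\<rho> i \<omega>\<bar> powr q = (\<delta> / \<alpha>) powr q * \<bar>N i \<omega>\<bar> powr q"
          by (simp only: powr_mult)
        then show ?thesis by (simp only: distrib_left add.commute mult.assoc)
      qed
      finally have "ennreal (T i \<omega>) \<le> ennreal (H i * (V * (w i)\<^sup>2) + H i * (\<delta> / \<alpha>) powr q * \<bar>N i \<omega>\<bar> powr q)"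
        by (rule ennreal_leI)
      also have "\<dots> = ennreal (H i * (V * (w i)\<^sup>2)) + ennreal (H i * (\<delta> / \<alpha>) powr q) * ennreal (\<bar>N i \<omega>\<bar> powr q)"
        using H[of i] V by (subst ennreal_plus) (auto simp: ennreal_mult[symmetric])
      finally show ?case .
    qed
    also have "\<dots> = ennreal (H i * (V * (w i)\<^sup>2)) +
        ennreal (H i * (\<delta> / \<alpha>) powr q) * (\<integral>\<^sup>+\<omega>. ennreal (\<bar>N i \<omega>\<bar> powr q) \<partial>M)"
      by (subst nn_integral_add) (auto simp: nn_integral_cmult emeasure_space_1)
    also have "\<dots> \<le> ennreal (H i * (V * (w i)\<^sup>2)) + ennreal (H i * (\<delta> / \<alpha>) powr q) * ennreal C"
      by (intro add_left_mono mult_left_mono Nq) auto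
    also have "\<dots> = ennreal (H i * (V * (w i)\<^sup>2) + H i * (\<delta> / \<alpha>) powr q * C)"
      using H[of i] V C by (subst ennreal_plus) (auto simp: ennreal_mult[symmetric])
    also have "H i * (V * (w i)\<^sup>2) + H i * (\<delta> / \<alpha>) powr q * C = H i * ((\<delta> / \<alpha>) powr q * C + V * (w i)\<^sup>2)"
      by (simp add: algebra_simps)
    finally show ?thesis .
  qed
  have main: "?int \<and> ?nonneg \<and> (LINT \<omega>|completion M. D \<omega>) \<le> ?bound n" if n: "n \<ge> 1" for n
  proof -
    let ?tail = "\<lambda>i. if n \<le> i then real (Suc i) powr (- \<beta>) else 0"
    let ?h = "2 * 4 powr q * A"
    let ?c = "(\<delta> / \<alpha>) powr q * C"
    define b where "b i = (if i < n then \<alpha> / 2 * (w i)\<^sup>2 + \<delta>\<^sup>2 / \<alpha> * C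
        else H i * (?c + V * (w i)\<^sup>2))" for i
    define B where "B i = \<alpha> / 2 * (w i)\<^sup>2 + (if i < n then \<delta>\<^sup>2 / \<alpha> * C else 0) +
        ?h * (?c * ?tail i + real n powr (- \<beta>) * V * (w i)\<^sup>2)" for i
    have b_nn: "0 \<le> b i" for i using \<alpha> C V H[of i] by (auto simp: b_def)
    have b_le: "b i \<le> B i" for i
    proof (cases "i < n")
      case True
      then show ?thesis using A V by (simp add: b_def B_def)
    next
      case False
      have "real (Suc i) powr (- \<beta>) \<le> real n powr (- \<beta>)"
        using False n \<beta> by (intro powr_mono2') auto
      then have "real (Suc i) powr (- \<beta>) * (V * (w i)\<^sup>2) \<le> real n powr (- \<beta>) * (V * (w i)\<^sup>2)"
        using V by (intro mult_right_mono) auto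
      then have "?h * (?c * real (Suc i) powr (- \<beta>) + real (Suc i) powr (- \<beta>) * (V * (w i)\<^sup>2)) \<le>
          ?h * (?c * real (Suc i) powr (- \<beta>) + real n powr (- \<beta>) * (V * (w i)\<^sup>2))"
        using A by (intro mult_left_mono) auto
      moreover have "0 \<le> \<alpha> / 2 * (w i)\<^sup>2" using \<alpha> by simp
      moreover have "b i = ?h * (?c * real (Suc i) powr (- \<beta>) + real (Suc i) powr (- \<beta>) * (V * (w i)\<^sup>2))"
        using False by (simp add: b_def H_def algebra_simps)
      moreover have "B i = \<alpha> / 2 * (w i)\<^sup>2 + ?h * (?c * real (Suc i) powr (- \<beta>) + real n powr (- \<beta>) * (V * (w i)\<^sup>2))"
        using False by (simp add: B_def mult.assoc)
      ultimately show ?thesis by linarith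
    qed
    have fin: "(\<lambda>i. if i < n then \<delta>\<^sup>2 / \<alpha> * C else 0) sums (real n * (\<delta>\<^sup>2 / \<alpha> * C))"
      using sums_If_finite_set[of "{..<n}" "\<lambda>_. \<delta>\<^sup>2 / \<alpha> * C"] by simp
    have B_sums: "B sums (\<alpha> / 2 * W + real n * (\<delta>\<^sup>2 / \<alpha> * C) +
        ?h * (?c * suminf ?tail + real n powr (- \<beta>) * V * W))"
      unfolding B_def
      by (intro sums_add sums_mult fin w(1) summable_sums powr_tail_sum(1)[OF \<beta> n])
    have b_sum: "summable b"
      by (rule summable_comparison_test'[OF sums_summable[OF B_sums], of 0]) (use b_nn b_le in auto)
    have T_b: "(\<integral>\<^sup>+\<omega>. ennreal (T i \<omega>) \<partial>M) \<le> ennreal (b i)" for i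
      using low[of i] high[of i] by (simp add: b_def)
    note res = integrable_completion_sums[of T M D b, OF T_meas _ T_D T_b b_nn b_sum]
    have "suminf b \<le> suminf B"
      by (intro suminf_le b_le b_sum sums_summable[OF B_sums])
    also have "\<dots> = \<alpha> / 2 * W + real n * (\<delta>\<^sup>2 / \<alpha> * C) + ?h * (?c * suminf ?tail + real n powr (- \<beta>) * V * W)"
      using B_sums by (simp add: sums_iff)
    also have "\<dots> \<le> ?bound n"
      using A C by (intro add_left_mono mult_left_mono add_right_mono powr_tail_sum(2)[OF \<beta> n]) auto
    finally show ?thesis using res T_nn by auto
  qed
  show ?int ?nonneg using main[of 1] by simp_all
  show "(LINT \<omega>|completion M. D \<omega>) \<le> ?bound n" if "n \<ge> 1" for n using main[OF that] by simp
qed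

section \<open>The convergence rate\<close>

text \<open>All powers of $\delta$ are compared by means of $\kappa = 4\sigma(1 - \kappa)$; the third term has
  the exponent $q\kappa/2$, the fourth $2(1-\kappa)\beta \ge \kappa$.\<close>

lemma bregman_rate:
  fixes f \<alpha> :: "real \<Rightarrow> real" and \<sigma> q C \<kappa> \<beta> :: real
  assumes \<sigma>: "\<sigma> > 1/2" and q: "q \<ge> 2" and \<kappa>: "\<kappa> = 4 * \<sigma> / (4 * \<sigma> + 1)"
    and \<beta>: "\<beta> = q * (\<sigma> - 1/2) + 1" and C: "C \<ge> 0"
    and alpha: "\<alpha> \<in> \<Theta>[at_right 0](\<lambda>\<delta>. \<delta> powr \<kappa>)" and alpha_pos: "\<And>\<delta>. \<delta> > 0 \<Longrightarrow> \<alpha> \<delta> > 0"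
    and f_nn: "\<And>\<delta>. \<delta> > 0 \<Longrightarrow> 0 \<le> f \<delta>"
    and f_le: "\<And>\<delta> n. \<delta> > 0 \<Longrightarrow> n \<ge> 1 \<Longrightarrow> f \<delta> \<le>
      C * (\<alpha> \<delta> + real n * \<delta>\<^sup>2 / \<alpha> \<delta> + (\<delta> / \<alpha> \<delta>) powr q * real n powr (1 - \<beta>) + real n powr (- \<beta>))"
  shows "f \<in> O[at_right 0](\<lambda>\<delta>. \<delta> powr \<kappa>)"
proof -
  obtain c1 where c1: "c1 > 0" "\<forall>\<^sub>F \<delta> in at_right 0. norm (\<alpha> \<delta>) \<ge> c1 * norm (\<delta> powr \<kappa>)"
    using alpha by (auto simp: bigtheta_def elim: landau_omega.bigE)
  obtain c2 where c2: "c2 > 0" "\<forall>\<^sub>F \<delta> in at_right 0. norm (\<alpha> \<delta>) \<le> c2 * norm (\<delta> powr \<kappa>)"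
    using alpha by (auto simp: bigtheta_def elim: landau_o.bigE)
  have \<kappa>1: "1 - \<kappa> = 1 / (4 * \<sigma> + 1)" using \<sigma> by (simp add: \<kappa> field_simps)
  have \<kappa>0: "0 < \<kappa>" "\<kappa> < 1" using \<sigma> by (simp_all add: \<kappa> field_simps)
  have \<kappa>\<sigma>: "\<kappa> = 4 * \<sigma> * (1 - \<kappa>)" unfolding \<kappa>1 by (simp add: \<kappa>)
  have \<beta>1: "\<beta> > 1" using \<sigma> q by (simp add: \<beta>)
  have \<beta>2: "\<beta> \<ge> 2 * \<sigma>"
    using mult_right_mono[of 2 q "\<sigma> - 1/2"] q \<sigma> by (simp add: \<beta>)
  have "\<forall>\<^sub>F \<delta> in at_right 0. norm (f \<delta>) \<le> (C * (c2 + 2 / c1 + c1 powr (- q) + 1)) * norm (\<delta> powr \<kappa>)"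
    using c1(2) c2(2) eventually_at_right_less[of 0] eventually_at_right_real[of 0 1, simplified]
  proof eventually_elim
    case (elim \<delta>)
    then have \<delta>: "0 < \<delta>" "\<delta> < 1" by auto
    note \<alpha> = alpha_pos[OF \<delta>(1)]
    have \<alpha>_lo: "c1 * \<delta> powr \<kappa> \<le> \<alpha> \<delta>" and \<alpha>_hi: "\<alpha> \<delta> \<le> c2 * \<delta> powr \<kappa>"
      using elim \<alpha> by auto
    have mono: "\<delta> powr x \<le> \<delta> powr y" if "y \<le> x" for x y
      using that \<delta> by (intro powr_mono') auto
    \<comment> \<open>with this cut-off $n\delta^2/\alpha$ is exactly of order $\delta^\kappa$\<close>
    define \<Lambda> where "\<Lambda> = \<delta> powr (- 2 * (1 - \<kappa>))"
    define n where "n = nat \<lceil>\<Lambda>\<rceil>"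
    have \<Lambda>1: "\<Lambda> \<ge> 1" using mono[of "- 2 * (1 - \<kappa>)" 0] \<kappa>0 \<delta> by (simp add: \<Lambda>_def)
    have n: "\<Lambda> \<le> real n" "real n \<le> 2 * \<Lambda>" "n \<ge> 1"
      using \<Lambda>1 by (auto simp: n_def) linarith+
    have 1: "real n * \<delta>\<^sup>2 / \<alpha> \<delta> \<le> 2 / c1 * \<delta> powr \<kappa>"
    proof -
      have "real n * \<delta>\<^sup>2 / \<alpha> \<delta> \<le> (2 * \<Lambda>) * \<delta>\<^sup>2 / (c1 * \<delta> powr \<kappa>)"
        using n \<alpha>_lo \<delta> c1 by (intro frac_le mult_mono) auto
      also have "\<dots> = 2 / c1 * (\<delta> powr (- 2 * (1 - \<kappa>)) * \<delta> powr 2 / \<delta> powr \<kappa>)"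
        using \<delta> by (simp add: \<Lambda>_def)
      also have "\<delta> powr (- 2 * (1 - \<kappa>)) * \<delta> powr 2 / \<delta> powr \<kappa> = \<delta> powr \<kappa>"
        by (simp add: powr_add[symmetric] powr_diff[symmetric])
      finally show ?thesis .
    qed
    have 2: "(\<delta> / \<alpha> \<delta>) powr q * real n powr (1 - \<beta>) \<le> c1 powr (- q) * \<delta> powr \<kappa>"
    proof -
      have "\<delta> / \<alpha> \<delta> \<le> \<delta> / (c1 * \<delta> powr \<kappa>)"
        using \<alpha>_lo \<delta> c1 \<alpha> by (intro divide_left_mono) auto
      also have "\<dots> = \<delta> powr (1 - \<kappa>) / c1"
        using \<delta> by (simp add: powr_diff)
      finally have "(\<delta> / \<alpha> \<delta>) powr q \<le> (\<delta> powr (1 - \<kappa>) / c1) powr q"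
        using \<delta> \<alpha> q by (intro powr_mono2) auto
      also have "\<dots> = c1 powr (- q) * \<delta> powr ((1 - \<kappa>) * q)"
      proof -
        have "(\<delta> powr (1 - \<kappa>) / c1) powr q = (\<delta> powr (1 - \<kappa>)) powr q / c1 powr q"
          using c1 by (simp add: powr_divide)
        then show ?thesis by (simp add: powr_powr powr_minus divide_inverse)
      qed
      finally have a: "(\<delta> / \<alpha> \<delta>) powr q \<le> c1 powr (- q) * \<delta> powr ((1 - \<kappa>) * q)" .
      have "real n powr (1 - \<beta>) \<le> \<Lambda> powr (1 - \<beta>)"
        using n \<Lambda>1 \<beta>1 by (intro powr_mono2') auto
      also have "\<dots> = \<delta> powr (- 2 * (1 - \<kappa>) * (1 - \<beta>))"
        by (simp add: \<Lambda>_def powr_powr)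
      finally have b: "real n powr (1 - \<beta>) \<le> \<delta> powr (- 2 * (1 - \<kappa>) * (1 - \<beta>))" .
      have "(\<delta> / \<alpha> \<delta>) powr q * real n powr (1 - \<beta>) \<le>
          c1 powr (- q) * \<delta> powr ((1 - \<kappa>) * q) * \<delta> powr (- 2 * (1 - \<kappa>) * (1 - \<beta>))"
        using a b by (intro mult_mono) auto
      also have "\<dots> = c1 powr (- q) * \<delta> powr ((1 - \<kappa>) * q + (- 2 * (1 - \<kappa>) * (1 - \<beta>)))"
        by (simp only: powr_add mult.assoc)
      also have "(1 - \<kappa>) * q + (- 2 * (1 - \<kappa>) * (1 - \<beta>)) = q / 2 * \<kappa>"
        by (subst (3) \<kappa>\<sigma>) (simp add: \<beta> field_simps)
      also have "c1 powr (- q) * \<delta> powr (q / 2 * \<kappa>) \<le> c1 powr (- q) * \<delta> powr \<kappa>"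
        using mult_right_mono[of 1 "q / 2" \<kappa>] \<kappa>0 q by (intro mult_left_mono mono) auto
      finally show ?thesis .
    qed
    have 3: "real n powr (- \<beta>) \<le> \<delta> powr \<kappa>"
    proof -
      have "real n powr (- \<beta>) \<le> \<Lambda> powr (- \<beta>)"
        using n \<Lambda>1 \<beta>1 by (intro powr_mono2') auto
      also have "\<dots> = \<delta> powr (2 * (1 - \<kappa>) * \<beta>)"
        by (simp add: \<Lambda>_def powr_powr algebra_simps)
      also have "\<dots> \<le> \<delta> powr \<kappa>"
      proof (rule mono)
        have "2 * (1 - \<kappa>) * (2 * \<sigma>) \<le> 2 * (1 - \<kappa>) * \<beta>"
          using \<beta>2 \<kappa>0 by (intro mult_left_mono) auto
        then show "\<kappa> \<le> 2 * (1 - \<kappa>) * \<beta>" using \<kappa>\<sigma> by (simp add: algebra_simps)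
      qed
      finally show ?thesis .
    qed
    have "f \<delta> \<le> C * (\<alpha> \<delta> + real n * \<delta>\<^sup>2 / \<alpha> \<delta> + (\<delta> / \<alpha> \<delta>) powr q * real n powr (1 - \<beta>) + real n powr (- \<beta>))"
      by (rule f_le[OF \<delta>(1) n(3)])
    also have "\<dots> \<le> C * (c2 * \<delta> powr \<kappa> + 2 / c1 * \<delta> powr \<kappa> + c1 powr (- q) * \<delta> powr \<kappa> + \<delta> powr \<kappa>)"
      using \<alpha>_hi 1 2 3 C by (intro mult_left_mono add_mono) auto
    finally show ?case using f_nn[OF \<delta>(1)] by (simp add: algebra_simps)
  qed
  then show ?thesis by (rule bigoI)
qed

text \<open>The exponents combine because $p(1 - q) = -q$.\<close>

lemma besov_data_decay:
  assumes p: "p > 1" and q: "q = p / (p - 1)" and l: "l \<ge> 1"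
    and k: "0 < k" "k \<le> C * real l powr (- t)" and C: "C > 0"
  shows "k powr q * besov_weight p s l powr (1 - q) \<le>
    C powr q * real l powr (- (q * (s + t - 1/2) + 1))"
proof -
  have q0: "q > 0" using p q by simp
  have pq: "p * (1 - q) = - q" using p q by (simp add: field_simps)
  have "k powr q \<le> (C * real l powr (- t)) powr q"
    using k q0 by (intro powr_mono2) auto
  also have "\<dots> = C powr q * real l powr (- t * q)"
    by (simp add: powr_mult powr_powr)
  finally have "k powr q * besov_weight p s l powr (1 - q) \<le>
      C powr q * real l powr (- t * q) * real l powr ((p * (s + 1/2) - 1) * (1 - q))"
    by (intro mult_mono) (auto simp: besov_weight_def powr_powr)
  also have "\<dots> = C powr q * real l powr (- t * q + (p * (s + 1/2) - 1) * (1 - q))"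
    by (simp only: powr_add mult.assoc)
  also have "- t * q + (p * (s + 1/2) - 1) * (1 - q) = - t * q + (p * (1 - q)) * (s + 1/2) - 1 + q"
    by (simp add: algebra_simps)
  also have "\<dots> = - (q * (s + t - 1/2) + 1)"
    unfolding pq by (simp add: field_simps)
  finally show ?thesis .
qed

text \<open>Square summability of $k_l N_l$ says that the adjoint of the operator maps the noise into $L^2$;
  every term of the pairing is then bounded by a sum of squares from convergent series.\<close>

lemma white_noise_data_pairable:
  assumes psi: "orthonormal_basis \<psi>"
    and K: "\<And>x i. inner (K x) (\<psi> (Suc i)) = k i * inner x (\<psi> (Suc i))"
    and N: "summable (\<lambda>i. (k i)\<^sup>2 * (N (Suc i))\<^sup>2)"
  shows "(\<lambda>l. inner (K u) (\<psi> l) * (inner (K v) (\<psi> l) + \<delta> * N l)) summable_on {1..}"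
proof -
  note e = orthonormal_basis_shift[OF psi]
  let ?g = "\<lambda>l. inner (K u) (\<psi> l) * (inner (K v) (\<psi> l) + \<delta> * N l)"
  have "summable (\<lambda>i. (inner (K u) (\<psi> (Suc i)))\<^sup>2 + (inner (K v) (\<psi> (Suc i)))\<^sup>2 +
      ((inner u (\<psi> (Suc i)))\<^sup>2 + \<delta>\<^sup>2 * ((k i)\<^sup>2 * (N (Suc i))\<^sup>2)))"
    by (intro summable_add summable_mult N sums_summable[OF parseval_norm[OF e]])
  then have "summable (\<lambda>i. norm (?g (Suc i)))"
  proof (rule summable_comparison_test'[where N = 0])
    fix i
    have "?g (Suc i) = inner (K u) (\<psi> (Suc i)) * inner (K v) (\<psi> (Suc i)) +
        inner u (\<psi> (Suc i)) * (\<delta> * k i * N (Suc i))"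
      by (simp add: K algebra_simps)
    then have "\<bar>?g (Suc i)\<bar> \<le> \<bar>inner (K u) (\<psi> (Suc i)) * inner (K v) (\<psi> (Suc i))\<bar> +
        \<bar>inner u (\<psi> (Suc i)) * (\<delta> * k i * N (Suc i))\<bar>"
      by (metis abs_triangle_ineq)
    also have "\<dots> \<le> (inner (K u) (\<psi> (Suc i)))\<^sup>2 + (inner (K v) (\<psi> (Suc i)))\<^sup>2 +
      ((inner u (\<psi> (Suc i)))\<^sup>2 + (\<delta> * k i * N (Suc i))\<^sup>2)"
      by (intro add_mono abs_mult_le_squares)
    finally show "norm (norm (?g (Suc i))) \<le> (inner (K u) (\<psi> (Suc i)))\<^sup>2 + (inner (K v) (\<psi> (Suc i)))\<^sup>2 +
      ((inner u (\<psi> (Suc i)))\<^sup>2 + \<delta>\<^sup>2 * ((k i)\<^sup>2 * (N (Suc i))\<^sup>2))"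
      by (simp add: power_mult_distrib mult.assoc)
  qed
  then have "(\<lambda>i. ?g (Suc i)) summable_on UNIV"
    by (rule norm_summable_imp_summable_on)
  then have "?g summable_on (Suc ` UNIV)"
    by (subst summable_on_reindex) (auto simp: o_def)
  moreover have "Suc ` UNIV = {1..}" by (auto simp: image_iff Suc_le_eq gr0_conv_Suc)
  ultimately show ?thesis by simp
qed

theorem theorem4p9:
  fixes p s t \<kappa> :: real and r :: nat
    and \<psi> :: "nat \<Rightarrow> l2_torus"
    and K :: "l2_torus \<Rightarrow> l2_torus"
    and R :: "l2_torus \<Rightarrow> ereal"
    and udag mudag w :: l2_torus
    and M :: "'w measure"
    and N :: "'w \<Rightarrow> (real \<Rightarrow> real) \<Rightarrow> real"
    and Nc :: "nat \<Rightarrow> 'w \<Rightarrow> real"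
    and F :: "real \<Rightarrow> 'w \<Rightarrow> nat \<Rightarrow> real"
    and \<alpha> :: "real \<Rightarrow> real"
    and U \<mu> :: "real \<Rightarrow> 'w \<Rightarrow> l2_torus"
  assumes p: "1 < p" "p < 2"
    and s: "s \<ge> 1 / p - 1 / 2"
    and t: "t > 1 / 2"
    and psi: "wavelet_basis r \<psi>" and r: "max s t < real r"
    and K: "bounded_linear K"
    and K_diag: "\<And>l l'. l \<ge> 1 \<Longrightarrow> l' \<ge> 1 \<Longrightarrow> l \<noteq> l' \<Longrightarrow> inner (\<psi> l) (K (\<psi> l')) = 0"
    and K_decay: "\<exists>c>0. \<exists>C>0. \<forall>l\<ge>1. c * real l powr (- t) \<le> inner (\<psi> l) (K (\<psi> l)) \<and>
                    inner (\<psi> l) (K (\<psi> l)) \<le> C * real l powr (- t)"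
    and R: "R = besov_penalty \<psi> p s"
    and mudag: "mudag \<in> subdifferential R udag"
    and source: "mudag = adjoint K w"
    and prob: "prob_space M"
    and N: "white_noise M N"
    and Nc: "\<And>l. l \<ge> 1 \<Longrightarrow> noise_pairing M N (\<psi> l) (Nc l)"
    and F: "F = (\<lambda>\<delta> \<omega> l. inner (K udag) (\<psi> l) + \<delta> * Nc l \<omega>)"
    and kappa: "\<kappa> = 4 * (s + t) / (4 * (s + t) + 1)"
    and alpha_pos: "\<And>\<delta>. \<delta> > 0 \<Longrightarrow> \<alpha> \<delta> > 0"
    and alpha: "\<alpha> \<in> \<Theta>[at_right 0](\<lambda>\<delta>. \<delta> powr \<kappa>)"
    and U_min: "\<And>\<delta>. \<delta> > 0 \<Longrightarrow> AE \<omega> in M.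
                  \<forall>v. tikhonov \<psi> K R (\<alpha> \<delta>) (F \<delta> \<omega>) (U \<delta> \<omega>) \<le> tikhonov \<psi> K R (\<alpha> \<delta>) (F \<delta> \<omega>) v"
    and mu_subgrad: "\<And>\<delta>. \<delta> > 0 \<Longrightarrow> AE \<omega> in M. \<mu> \<delta> \<omega> \<in> subdifferential R (U \<delta> \<omega>)"
    and mu_opt: "\<And>\<delta>. \<delta> > 0 \<Longrightarrow> AE \<omega> in M.
                  dual_adjoint \<psi> K (\<lambda>l. inner (K (U \<delta> \<omega>)) (\<psi> l) - F \<delta> \<omega> l) + \<alpha> \<delta> *\<^sub>R \<mu> \<delta> \<omega> = 0"
  shows "(\<forall>\<delta>>0. integrable (completion M) (\<lambda>\<omega>. sym_bregman (\<mu> \<delta> \<omega>) mudag (U \<delta> \<omega>) udag)) \<and>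
         (\<lambda>\<delta>. LINT \<omega>|completion M. sym_bregman (\<mu> \<delta> \<omega>) mudag (U \<delta> \<omega>) udag)
           \<in> O[at_right 0](\<lambda>\<delta>. \<delta> powr \<kappa>)"
proof -
  note orth = psi[unfolded wavelet_basis_def, THEN conjunct1]
  note e = orthonormal_basis_shift[OF orth]
  define k where "k i = inner (\<psi> (Suc i)) (K (\<psi> (Suc i)))" for i
  have diag: "inner (\<psi> (Suc i)) (K (\<psi> (Suc j))) = 0" if "i \<noteq> j" for i j
    using K_diag[of "Suc i" "Suc j"] that by simp
  have coord: "inner (K x) (\<psi> (Suc i)) = k i * inner x (\<psi> (Suc i))" for x i
    unfolding k_def by (rule diagonal_coordinates[OF e K]) (rule diag)
  have K_psi: "K (\<psi> (Suc i)) = k i *\<^sub>R \<psi> (Suc i)" for i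
    using diagonal_on_basis[where K = K and i = i, OF e diag] by (simp add: k_def)
  obtain c CK where c: "c > 0" and CK: "CK > 0"
    and k_lo: "\<And>i. c * real (Suc i) powr (- t) \<le> k i" and k_hi: "\<And>i. k i \<le> CK * real (Suc i) powr (- t)"
    using K_decay unfolding k_def by (metis One_nat_def Suc_le_mono le0)
  have k: "k i > 0" for i
    by (rule less_le_trans[OF _ k_lo]) (use c in simp)
  define a where "a i = besov_weight p s (Suc i)" for i
  have a: "a i > 0" for i by (simp add: a_def besov_weight_def)
  define v where "v i = inner udag (\<psi> (Suc i))" for i
  define w' where "w' i = inner w (\<psi> (Suc i))" for i
  have subgrad: "inner m (\<psi> (Suc i)) = a i * signed_powr (p - 1) (inner u (\<psi> (Suc i)))"
    if "m \<in> subdifferential R u" for m u i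
    unfolding a_def by (rule besov_subdifferential_coordinate[OF orth p(1)]) (use that R in auto)
  have adj: "adjoint K = K"
    by (rule diagonal_adjoint[OF e K]) (rule diag)
  have mudag_coord: "inner mudag (\<psi> (Suc i)) = k i * w' i" for i
    using source adj coord[of w i] by (simp add: w'_def)
  have src: "a i * signed_powr (p - 1) (v i) = k i * w' i" for i
    using subgrad[OF mudag, of i] mudag_coord[of i] by (simp add: v_def)

  define q where "q = p / (p - 1)"
  have q2: "q \<ge> 2" using p by (simp add: q_def field_simps)
  define \<sigma> where "\<sigma> = s + t"
  have "1 / p > 1 / 2" using p by (simp add: field_simps)
  then have \<sigma>: "\<sigma> > 1/2" using s t by (simp add: \<sigma>_def)
  define \<beta> where "\<beta> = q * (\<sigma> - 1/2) + 1"
  have \<beta>: "\<beta> > 1" using q2 \<sigma> by (simp add: \<beta>_def)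
  have decay: "k i powr q * a i powr (1 - q) \<le> CK powr q * real (Suc i) powr (- \<beta>)" for i
    unfolding a_def \<beta>_def \<sigma>_def by (rule besov_data_decay[OF p(1) q_def _ k k_hi CK]) simp

  have psi1: "norm (\<psi> (Suc i)) = 1" for i
    using total_orthonormalD[OF e, of i i] by (simp add: norm_eq_sqrt_inner)
  have w_sums: "(\<lambda>i. (w' i)\<^sup>2) sums (norm w)\<^sup>2"
    unfolding w'_def by (rule parseval_norm[OF e])
  have w_powr: "\<bar>w' i\<bar> powr q \<le> norm w powr (q - 2) * (w' i)\<^sup>2" for i
  proof -
    have "\<bar>w' i\<bar> \<le> norm w"
      using Cauchy_Schwarz_ineq2[of w "\<psi> (Suc i)"] by (simp add: w'_def psi1)
    then have "\<bar>w' i\<bar> powr (q - 2) * \<bar>w' i\<bar> powr 2 \<le> norm w powr (q - 2) * \<bar>w' i\<bar> powr 2"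
      using q2 by (intro mult_right_mono powr_mono2) auto
    moreover have "\<bar>w' i\<bar> powr q = \<bar>w' i\<bar> powr (q - 2) * \<bar>w' i\<bar> powr 2"
      by (simp only: powr_add[symmetric] diff_add_cancel)
    ultimately show ?thesis by simp
  qed

  obtain C2 where C2: "C2 \<ge> 0" "\<And>f Z. norm f = 1 \<Longrightarrow> noise_pairing M N f Z \<Longrightarrow>
      (\<integral>\<^sup>+\<omega>. ennreal (\<bar>Z \<omega>\<bar> powr 2) \<partial>M) \<le> ennreal C2"
    using white_noise_coefficient_moment_bound[OF prob N, of 2] by auto
  obtain Cq where Cq: "Cq \<ge> 0" "\<And>f Z. norm f = 1 \<Longrightarrow> noise_pairing M N f Z \<Longrightarrow>
      (\<integral>\<^sup>+\<omega>. ennreal (\<bar>Z \<omega>\<bar> powr q) \<partial>M) \<le> ennreal Cq"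
    using white_noise_coefficient_moment_bound[OF prob N, of q] q2 by auto
  define C where "C = max C2 Cq"
  have C: "C \<ge> 0" "ennreal C2 \<le> ennreal C" "ennreal Cq \<le> ennreal C"
    using C2 by (auto simp: C_def intro: ennreal_leI)
  define n where "n i = Nc (Suc i)" for i
  have n_pair: "noise_pairing M N (\<psi> (Suc i)) (n i)" for i
    unfolding n_def by (rule Nc) simp
  have n_meas: "n i \<in> borel_measurable M" for i
    using n_pair[of i] by (simp add: noise_pairing_def)
  have n2: "(\<integral>\<^sup>+\<omega>. ennreal ((n i \<omega>)\<^sup>2) \<partial>M) \<le> ennreal C" for i
    using order_trans[OF C2(2)[OF psi1 n_pair] C(2), of i] by simp
  have nq: "(\<integral>\<^sup>+\<omega>. ennreal (\<bar>n i \<omega>\<bar> powr q) \<partial>M) \<le> ennreal C" for i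
    using order_trans[OF Cq(2)[OF psi1 n_pair] C(3), of i] by simp

  \<comment> \<open>almost surely the pairing of the data with the range of \<open>K\<close> converges; this needs $t > 1/2$\<close>
  have noise_sum: "AE \<omega> in M. summable (\<lambda>i. (k i)\<^sup>2 * (n i \<omega>)\<^sup>2)"
  proof (rule AE_summable_of_nn_integral)
    show "(\<lambda>\<omega>. (k i)\<^sup>2 * (n i \<omega>)\<^sup>2) \<in> borel_measurable M" for i
      using n_meas[of i] by measurable
    show "(\<integral>\<^sup>+\<omega>. ennreal ((k i)\<^sup>2 * (n i \<omega>)\<^sup>2) \<partial>M) \<le> ennreal ((k i)\<^sup>2 * C)" for i
    proof -
      have "(\<integral>\<^sup>+\<omega>. ennreal ((k i)\<^sup>2 * (n i \<omega>)\<^sup>2) \<partial>M) = ennreal ((k i)\<^sup>2) * (\<integral>\<^sup>+\<omega>. ennreal ((n i \<omega>)\<^sup>2) \<partial>M)"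
        using n_meas[of i] by (simp add: ennreal_mult nn_integral_cmult)
      also have "\<dots> \<le> ennreal ((k i)\<^sup>2) * ennreal C"
        by (intro mult_left_mono n2) auto
      finally show ?thesis using C by (simp add: ennreal_mult)
    qed
    have "summable (\<lambda>i. CK\<^sup>2 * real (Suc i) powr (- 2 * t))"
      using t by (intro summable_mult) (subst summable_Suc_iff[of "\<lambda>i. real i powr (- 2 * t)"], simp add: summable_real_powr_iff)
    then have "summable (\<lambda>i. (k i)\<^sup>2)"
    proof (rule summable_comparison_test'[where N = 0])
      fix i
      have "(k i)\<^sup>2 \<le> (CK * real (Suc i) powr (- t))\<^sup>2"
        using k_hi[of i] k[of i] by (intro power_mono) auto
      also have "\<dots> = CK\<^sup>2 * real (Suc i) powr (- 2 * t)"
        by (simp add: power_mult_distrib power2_eq_square powr_add[symmetric])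
      finally show "norm ((k i)\<^sup>2) \<le> CK\<^sup>2 * real (Suc i) powr (- 2 * t)" by simp
    qed
    then show "summable (\<lambda>i. (k i)\<^sup>2 * C)" by (rule summable_mult2)
  qed (use C in auto)

  define D where "D = (\<lambda>\<delta> \<omega>. sym_bregman (\<mu> \<delta> \<omega>) mudag (U \<delta> \<omega>) udag)"
  define H where "H = 2 * 4 powr q * CK powr q"
  define V where "V = norm w powr (q - 2)"
  have model: "integrable (completion M) (D \<delta>)" "0 \<le> (LINT \<omega>|completion M. D \<delta> \<omega>)"
      "\<And>m. m \<ge> 1 \<Longrightarrow> (LINT \<omega>|completion M. D \<delta> \<omega>) \<le>
        \<alpha> \<delta> / 2 * (norm w)\<^sup>2 + real m * (\<delta>\<^sup>2 / \<alpha> \<delta> * C) +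
        H * ((\<delta> / \<alpha> \<delta>) powr q * C * (real m powr (1 - \<beta>) / (\<beta> - 1)) +
          real m powr (- \<beta>) * V * (norm w)\<^sup>2)"
    if \<delta>: "\<delta> > 0" for \<delta>
  proof -
    define u where "u i \<omega> = inner (U \<delta> \<omega>) (\<psi> (Suc i))" for i \<omega>
    have euler: "AE \<omega> in M. \<forall>i. k i * (k i * (u i \<omega> - v i) - \<delta> * n i \<omega>) +
        \<alpha> \<delta> * (a i * signed_powr (p - 1) (u i \<omega>)) = 0"
      using U_min[OF \<delta>] mu_subgrad[OF \<delta>] noise_sum
    proof eventually_elim
      case (elim \<omega>)
      have F_sum: "(\<lambda>l. inner (K (U \<delta> \<omega>)) (\<psi> l) * F \<delta> \<omega> l) summable_on {1..}"
      proof -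
        have "summable (\<lambda>i. (k i)\<^sup>2 * (Nc (Suc i) \<omega>)\<^sup>2)"
          using elim by (simp only: n_def)
        then show ?thesis
          unfolding F by (rule white_noise_data_pairable[OF orth coord])
      qed
      show ?case
      proof
        fix i
        have "k i * (inner (K (U \<delta> \<omega>)) (\<psi> (Suc i)) - F \<delta> \<omega> (Suc i)) +
            \<alpha> \<delta> * (besov_weight p s (Suc i) * signed_powr (p - 1) (inner (U \<delta> \<omega>) (\<psi> (Suc i)))) = 0"
          by (rule tikhonov_euler_coordinate[OF orth p(1) _ K K_psi _ F_sum])
             (use elim R besov_subdifferential_domain in auto)
        then show "k i * (k i * (u i \<omega> - v i) - \<delta> * n i \<omega>) + \<alpha> \<delta> * (a i * signed_powr (p - 1) (u i \<omega>)) = 0"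
          by (simp add: F coord u_def v_def n_def a_def algebra_simps)
      qed
    qed
    have D_sums: "AE \<omega> in M. (\<lambda>i. (a i * signed_powr (p - 1) (u i \<omega>) - k i * w' i) * (u i \<omega> - v i)) sums D \<delta> \<omega>"
      using mu_subgrad[OF \<delta>]
    proof eventually_elim
      case (elim \<omega>)
      have "(\<lambda>i. inner (\<mu> \<delta> \<omega> - mudag) (\<psi> (Suc i)) * inner (U \<delta> \<omega> - udag) (\<psi> (Suc i))) sums D \<delta> \<omega>"
        unfolding D_def sym_bregman_def by (rule parseval_sums[OF e])
      then show ?case
        by (simp add: inner_diff_left subgrad[OF elim] mudag_coord u_def v_def)
    qed
    note res = sequence_model_bregman[OF prob p(1) q_def \<delta> alpha_pos[OF \<delta>] k a src w_sums w_powr _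
        n_meas n2 nq C(1) decay _ \<beta> euler D_sums]
    show "integrable (completion M) (D \<delta>)" "0 \<le> (LINT \<omega>|completion M. D \<delta> \<omega>)"
      using res by simp_all
    show "\<And>m. m \<ge> 1 \<Longrightarrow> (LINT \<omega>|completion M. D \<delta> \<omega>) \<le>
        \<alpha> \<delta> / 2 * (norm w)\<^sup>2 + real m * (\<delta>\<^sup>2 / \<alpha> \<delta> * C) +
        H * ((\<delta> / \<alpha> \<delta>) powr q * C * (real m powr (1 - \<beta>) / (\<beta> - 1)) +
          real m powr (- \<beta>) * V * (norm w)\<^sup>2)"
      unfolding H_def V_def using res(3) by simp
  qed

  have HV: "H \<ge> 0" "V \<ge> 0" by (simp_all add: H_def V_def)
  define C' where "C' = (norm w)\<^sup>2 / 2 + C + H * C / (\<beta> - 1) + H * V * (norm w)\<^sup>2"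
  have parts: "0 \<le> (norm w)\<^sup>2 / 2" "0 \<le> H * C / (\<beta> - 1)" "0 \<le> H * V * (norm w)\<^sup>2"
    using HV C \<beta> by auto
  have C'_ge: "(norm w)\<^sup>2 / 2 \<le> C'" "C \<le> C'" "H * C / (\<beta> - 1) \<le> C'" "H * V * (norm w)\<^sup>2 \<le> C'"
    unfolding C'_def using parts C(1) by linarith+
  have rate: "(\<lambda>\<delta>. LINT \<omega>|completion M. D \<delta> \<omega>) \<in> O[at_right 0](\<lambda>\<delta>. \<delta> powr \<kappa>)"
  proof (rule bregman_rate[OF \<sigma> q2 _ \<beta>_def _ alpha alpha_pos model(2)])
    show "\<kappa> = 4 * \<sigma> / (4 * \<sigma> + 1)" by (simp add: kappa \<sigma>_def)
    show "C' \<ge> 0" using C'_ge(2) C(1) by linarith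
    fix \<delta> :: real and m :: nat assume \<delta>: "\<delta> > 0" and m: "m \<ge> 1"
    let ?x1 = "\<alpha> \<delta>" and ?x2 = "real m * \<delta>\<^sup>2 / \<alpha> \<delta>"
      and ?x3 = "(\<delta> / \<alpha> \<delta>) powr q * real m powr (1 - \<beta>)" and ?x4 = "real m powr (- \<beta>)"
    have "(LINT \<omega>|completion M. D \<delta> \<omega>) \<le>
        (norm w)\<^sup>2 / 2 * ?x1 + C * ?x2 + H * C / (\<beta> - 1) * ?x3 + H * V * (norm w)\<^sup>2 * ?x4"
      using model(3)[OF \<delta> m] by (simp add: algebra_simps)
    also have "\<dots> \<le> C' * ?x1 + C' * ?x2 + C' * ?x3 + C' * ?x4"
      using alpha_pos[OF \<delta>] by (intro add_mono mult_right_mono C'_ge) auto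
    finally show "(LINT \<omega>|completion M. D \<delta> \<omega>) \<le> C' * (?x1 + ?x2 + ?x3 + ?x4)"
      by (simp add: distrib_left)
  qed
  show ?thesis using model(1) rate unfolding D_def by blast
qed

end
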